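(* Let $(G,P)$ be a lattice ordered group and $X$ a (compactly aligned) product system of finite type over $P$ of right Hilbert $A$--$A$-bimodules. Let $\sigma^N$ be the dynamics on $\mathcal{NT}(X)$ arising from an injective homomorphism $N:G\to(0,\infty)$. Let $0<\beta<\infty$. If $\phi$ is a tracial state of $\mathcal F$ such that $$\phi\bigl(i_s(1^s_j)\,y\,i_r(1^r_l)^*\bigr)=\delta_{s,r}\,\delta_{j,l}\,N(s)^{-\beta}\phi(y)$$ for all $y\in\mathcal F$, $s,r\in P$, $j\in\{0,\dots,N_s-1\}$ and $l\in\{0,\dots,N_r-1\}$ (where for $s\neq r$ the left-hand side is read as $\phi\circ\Phi^\delta(i_s(1^s_j)yi_r(1^r_l)^* )$), then $\omega:=\phi\circ\Phi^\delta$ is a KMS$_\beta$ state of $(\mathcal{NT}(X),\sigma^N)$.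
   Context: $A$ is a unital $C^*$-algebra. A right Hilbert $A$--$A$-bimodule is a right Hilbert $A$-module $Y$ (inner product $A$-valued, conjugate-linear in the first variable) with a $*$-homomorphism $\varphi:A\to\mathcal L(Y)$ (adjointable operators) giving the left action. $\theta_{\xi,\eta}(\zeta)=\xi\cdot\langle\eta,\zeta\rangle$ and $\mathcal K(Y)=\overline{\mathrm{span}}\{\theta_{\xi,\eta}\}$. The balanced tensor product $X\otimes_A Y$ has inner product $\langle\xi_1\otimes\eta_1,\xi_2\otimes\eta_2\rangle=\langle\langle\xi_2,\xi_1\rangle\cdot\eta_1,\eta_2\rangle$ and left action $a\mapsto\varphi(a)\otimes I$. $(G,P)$ is a lattice ordered group: $P$ is an abelian cancellative semigroup with identity $e$, $G=PP^{-1}$ is its Grothendieck enveloping group, $P\cap P^{-1}=\{e\}$, and any $s,r\in G$ have a least common upper bound $s\vee r\in G$ for the order $s\le r\Leftrightarrow s^{-1}r\in P$. A product system over $P$ is $X=\bigsqcup_{s\in P}X_s$ where each $X_s$ is a right Hilbert $A$--$A$-bimodule (inner product $\langle\cdot,\cdot\rangle_s$, left action $\varphi_s$, right action $\rho_s$, so $\rho_s(b)\xi=\xi\cdot b$), $X_e={}_AA_A$ with $\langle a,b\rangle=a^*b$, and $X$ is a semigroup with $X_sX_r\subseteq X_{sr}$, such that for $s,r\neq e$ the product extends to an isomorphism $F^{s,r}:X_s\otimes_AX_r\to X_{sr}$ of right Hilbert $A$--$A$-bimodules, while products with elements of $X_e=A$ are given by the bimodule actions. For $S\in\mathcal L(X_s)$,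 $i_s^{sr}(S)=F^{s,r}(S\otimes_AI_r)(F^{s,r})^*\in\mathcal L(X_{sr})$; $i_e^r=\varphi_r$, $i_s^s=\mathrm{id}$. $X$ is of finite type if for every $s\in P$ there are an integer $N_s\ge1$ and elements $1^s_0,\dots,1^s_{N_s-1}\in X_s$ with: (1) $X_s=\{\sum_j\varphi_s(a_j)1^s_j:a_j\in A\}$; (2) $X_s=\{\sum_j\rho_s(b_j)1^s_j:b_j\in A\}$; (3) $\langle1^s_j,1^s_k\rangle_s=\delta_{j,k}$; (4) for all $s,r\in P$ there is a map $\mathfrak m_{s,r}:\{0,\dots,N_s-1\}\times\{0,\dots,N_r-1\}\to\{0,\dots,N_{sr}-1\}$ with $F^{s,r}(1^s_j\otimes_A1^r_k)=1^{sr}_{\mathfrak m_{s,r}(j,k)}$. Then $\mathcal L(X_s)=\mathcal K(X_s)$ for all $s$, and $X$ is automatically compactly aligned, i.e. $i_s^{s\vee r}(S)i_r^{s\vee r}(T)\in\mathcal K(X_{s\vee r})$ for compact $S,T$. A Toeplitz representation $\psi:X\to C$ in a $C^*$-algebra $C$: $\psi_s=\psi|_{X_s}$ linear, $\psi_e$ a $*$-homomorphism, $\psi_s(\xi)\psi_r(\eta)=\psi_{sr}(\xi\eta)$, and $\psi_s(\xi)^*\psi_s(\eta)=\psi_e(\langle\xi,\eta\rangle_s)$. It induces $*$-homomorphisms $\psi^{(s)}:\mathcal K(X_s)\to C$, $\psi^{(s)}(\theta_{\xi,\eta})=\psi_s(\xi)\psi_s(\eta)^*$. It is Nica covariant if $\psi^{(s)}(S)\psi^{(r)}(T)=\psi^{(s\vee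 r)}(i_s^{s\vee r}(S)i_r^{s\vee r}(T))$ for $s,r\in P$, $S\in\mathcal K(X_s)$, $T\in\mathcal K(X_r)$. $\mathcal{NT}(X)$ is the $C^*$-algebra generated by a universal Nica covariant Toeplitz representation $i_X$, with $i_s=i_X|_{X_s}$; it is the closed span of the elements $i_s(\xi)i_r(\eta)^*$. The core $\mathcal F$ is the closed span of the elements $i_s(\xi)i_s(\eta)^*$, $\xi,\eta\in X_s$, $s\in P$. There is a conditional expectation $\Phi^\delta:\mathcal{NT}(X)\to\mathcal F$ with $\Phi^\delta(i_s(\xi)i_r(\eta)^* )=\delta_{s,r}\,i_s(\xi)i_s(\eta)^*$. For a homomorphism $N:G\to(0,\infty)$ (multiplicative), $\sigma^N:\mathbb R\to\mathrm{Aut}(\mathcal{NT}(X))$ is the dynamics with $\sigma^N_t(i_e(a))=i_e(a)$, $\sigma^N_t(i_s(\xi))=N(s)^{it}i_s(\xi)$. An element $c$ is $\sigma$-analytic if $t\mapsto\sigma_t(c)$ extends to an entire function. For $0<\beta<\infty$, a KMS$_\beta$ state of $(C,\sigma)$ is a state $\omega$ with $\omega(cd)=\omega(d\sigma_{i\beta}(c))$ for all $\sigma$-analytic $c,d$ (it suffices to check this on a set of analytic elements spanning a dense subspace). *)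

theory Defs
  imports "HOL-Analysis.Analysis" "HOL-Algebra.Module"
begin

section \<open>Complex vector spaces and C*-algebras with explicit carriers\<close>

definition complex_ring :: "complex ring" where
  "complex_ring = \<lparr>carrier = UNIV, mult = (*), one = 1, zero = 0, add = (+)\<rparr>"

text \<open>Scalar multiplication is the operation \<open>\<odot>\<close> of the library record of modules. As usual in
  HOL-Algebra, the ring multiplication and the unit of that record carry no information when it is
  used for a mere vector space.\<close>

abbreviation complex_space :: "(complex, 'v, 'm) module_scheme \<Rightarrow> bool" where
  "complex_space V \<equiv> module complex_ring V"

definition linear_on ::
    "(complex, 'v, 'm) module_scheme \<Rightarrow> (complex, 'w, 'n) module_scheme \<Rightarrow> ('v \<Rightarrow> 'w) \<Rightarrow> bool" where
  "linear_on V W f \<longleftrightarrow>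
     f \<in> carrier V \<rightarrow> carrier W \<and>
     (\<forall>x\<in>carrier V. \<forall>y\<in>carrier V. f (x \<oplus>\<^bsub>V\<^esub> y) = f x \<oplus>\<^bsub>W\<^esub> f y) \<and>
     (\<forall>c. \<forall>x\<in>carrier V. f (c \<odot>\<^bsub>V\<^esub> x) = c \<odot>\<^bsub>W\<^esub> f x)"

inductive_set lin_span :: "(complex, 'v, 'm) module_scheme \<Rightarrow> 'v set \<Rightarrow> 'v set"
  for V :: "(complex, 'v, 'm) module_scheme" and S :: "'v set" where
  span_zero: "\<zero>\<^bsub>V\<^esub> \<in> lin_span V S"
| span_step: "\<lbrakk>x \<in> lin_span V S; y \<in> S\<rbrakk> \<Longrightarrow> x \<oplus>\<^bsub>V\<^esub> c \<odot>\<^bsub>V\<^esub> y \<in> lin_span V S"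

definition complete_on :: "(complex, 'v, 'm) module_scheme \<Rightarrow> ('v \<Rightarrow> real) \<Rightarrow> bool" where
  "complete_on V nrm \<longleftrightarrow>
     (\<forall>x :: nat \<Rightarrow> 'v. range x \<subseteq> carrier V \<and>
        (\<forall>\<epsilon>>0. \<exists>M. \<forall>m\<ge>M. \<forall>n\<ge>M. nrm (x m \<ominus>\<^bsub>V\<^esub> x n) < \<epsilon>) \<longrightarrow>
        (\<exists>l\<in>carrier V. (\<lambda>n. nrm (x n \<ominus>\<^bsub>V\<^esub> l)) \<longlonglongrightarrow> 0))"

record 'a cstar = "(complex, 'a) module" +
  star :: "'a \<Rightarrow> 'a"
  cnorm :: "'a \<Rightarrow> real"

text \<open>C*-algebras are not assumed to be unital; the field \<open>one\<close> is only meaningful for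
  \<open>unital_cstar_algebra\<close>, and *-homomorphisms need not preserve it.\<close>

locale cstar_algebra =
  fixes C :: "'a cstar" (structure)
  assumes complex_space: "complex_space C"
    and mult_closed: "\<lbrakk>x \<in> carrier C; y \<in> carrier C\<rbrakk> \<Longrightarrow> x \<otimes> y \<in> carrier C"
    and mult_assoc: "\<lbrakk>x \<in> carrier C; y \<in> carrier C; z \<in> carrier C\<rbrakk> \<Longrightarrow> (x \<otimes> y) \<otimes> z = x \<otimes> (y \<otimes> z)"
    and distr_left: "\<lbrakk>x \<in> carrier C; y \<in> carrier C; z \<in> carrier C\<rbrakk>
          \<Longrightarrow> (x \<oplus> y) \<otimes> z = x \<otimes> z \<oplus> y \<otimes> z"
    and distr_right: "\<lbrakk>x \<in> carrier C; y \<in> carrier C; z \<in> carrier C\<rbrakk>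
          \<Longrightarrow> z \<otimes> (x \<oplus> y) = z \<otimes> x \<oplus> z \<otimes> y"
    and smult_mult_left: "\<lbrakk>x \<in> carrier C; y \<in> carrier C\<rbrakk> \<Longrightarrow> (c \<odot> x) \<otimes> y = c \<odot> (x \<otimes> y)"
    and smult_mult_right: "\<lbrakk>x \<in> carrier C; y \<in> carrier C\<rbrakk> \<Longrightarrow> x \<otimes> (c \<odot> y) = c \<odot> (x \<otimes> y)"
    and star_closed: "x \<in> carrier C \<Longrightarrow> star C x \<in> carrier C"
    and star_star: "x \<in> carrier C \<Longrightarrow> star C (star C x) = x"
    and star_add: "\<lbrakk>x \<in> carrier C; y \<in> carrier C\<rbrakk> \<Longrightarrow> star C (x \<oplus> y) = star C x \<oplus> star C y"
    and star_smult: "x \<in> carrier C \<Longrightarrow> star C (c \<odot> x) = cnj c \<odot> star C x"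
    and star_mult: "\<lbrakk>x \<in> carrier C; y \<in> carrier C\<rbrakk> \<Longrightarrow> star C (x \<otimes> y) = star C y \<otimes> star C x"
    and norm_nonneg: "x \<in> carrier C \<Longrightarrow> 0 \<le> cnorm C x"
    and norm_zero_iff: "x \<in> carrier C \<Longrightarrow> cnorm C x = 0 \<longleftrightarrow> x = \<zero>"
    and norm_triangle: "\<lbrakk>x \<in> carrier C; y \<in> carrier C\<rbrakk> \<Longrightarrow> cnorm C (x \<oplus> y) \<le> cnorm C x + cnorm C y"
    and norm_smult: "x \<in> carrier C \<Longrightarrow> cnorm C (c \<odot> x) = cmod c * cnorm C x"
    and norm_mult: "\<lbrakk>x \<in> carrier C; y \<in> carrier C\<rbrakk> \<Longrightarrow> cnorm C (x \<otimes> y) \<le> cnorm C x * cnorm C y"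
    and cstar_identity: "x \<in> carrier C \<Longrightarrow> cnorm C (star C x \<otimes> x) = (cnorm C x)\<^sup>2"
    and complete: "complete_on C (cnorm C)"

locale unital_cstar_algebra = cstar_algebra +
  assumes one_closed: "\<one> \<in> carrier C"
    and one_left: "x \<in> carrier C \<Longrightarrow> \<one> \<otimes> x = x"
    and one_right: "x \<in> carrier C \<Longrightarrow> x \<otimes> \<one> = x"

definition positive :: "'a cstar \<Rightarrow> 'a \<Rightarrow> bool" where
  "positive C a \<longleftrightarrow> (\<exists>b\<in>carrier C. a = star C b \<otimes>\<^bsub>C\<^esub> b)"

definition star_hom :: "'a cstar \<Rightarrow> 'b cstar \<Rightarrow> ('a \<Rightarrow> 'b) \<Rightarrow> bool" where
  "star_hom C D f \<longleftrightarrow>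
     linear_on C D f \<and>
     (\<forall>x\<in>carrier C. \<forall>y\<in>carrier C. f (x \<otimes>\<^bsub>C\<^esub> y) = f x \<otimes>\<^bsub>D\<^esub> f y) \<and>
     (\<forall>x\<in>carrier C. f (star C x) = star D (f x))"

definition norm_closure :: "'a cstar \<Rightarrow> 'a set \<Rightarrow> 'a set" where
  "norm_closure C S = {x \<in> carrier C. \<forall>\<epsilon>>0. \<exists>y\<in>S. cnorm C (x \<ominus>\<^bsub>C\<^esub> y) < \<epsilon>}"

definition closed_span :: "'a cstar \<Rightarrow> 'a set \<Rightarrow> 'a set" where
  "closed_span C S = norm_closure C (lin_span C S)"

definition cstar_subalgebra :: "'a cstar \<Rightarrow> 'a set \<Rightarrow> bool" where
  "cstar_subalgebra C B \<longleftrightarrow>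
     B \<subseteq> carrier C \<and> closed_span C B = B \<and>
     (\<forall>x\<in>B. \<forall>y\<in>B. x \<otimes>\<^bsub>C\<^esub> y \<in> B) \<and> (\<forall>x\<in>B. star C x \<in> B)"

definition generated_cstar :: "'a cstar \<Rightarrow> 'a set \<Rightarrow> 'a set" where
  "generated_cstar C S = \<Inter>{B. cstar_subalgebra C B \<and> S \<subseteq> B}"

section \<open>Hilbert bimodules\<close>

text \<open>\<open>ract\<close> and \<open>lact\<close> are the right and left actions of the coefficient algebra, and
  \<open>ip\<close> is the algebra-valued inner product, conjugate-linear in the first variable.\<close>

record ('a, 'x) bimod = "(complex, 'x) module" +
  ract :: "'x \<Rightarrow> 'a \<Rightarrow> 'x"
  lact :: "'a \<Rightarrow> 'x \<Rightarrow> 'x"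
  ip :: "'x \<Rightarrow> 'x \<Rightarrow> 'a"

definition hnorm :: "'a cstar \<Rightarrow> ('a, 'x) bimod \<Rightarrow> 'x \<Rightarrow> real" where
  "hnorm A Y \<xi> = sqrt (cnorm A (ip Y \<xi> \<xi>))"

locale hilbert_module =
  fixes A :: "'a cstar" and Y :: "('a, 'x) bimod"
  assumes complex_space: "complex_space Y"
    and ract_closed: "\<lbrakk>\<xi> \<in> carrier Y; a \<in> carrier A\<rbrakk> \<Longrightarrow> ract Y \<xi> a \<in> carrier Y"
    and ract_add_left: "\<lbrakk>\<xi> \<in> carrier Y; \<eta> \<in> carrier Y; a \<in> carrier A\<rbrakk>
          \<Longrightarrow> ract Y (\<xi> \<oplus>\<^bsub>Y\<^esub> \<eta>) a = ract Y \<xi> a \<oplus>\<^bsub>Y\<^esub> ract Y \<eta> a"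
    and ract_add_right: "\<lbrakk>\<xi> \<in> carrier Y; a \<in> carrier A; b \<in> carrier A\<rbrakk>
          \<Longrightarrow> ract Y \<xi> (a \<oplus>\<^bsub>A\<^esub> b) = ract Y \<xi> a \<oplus>\<^bsub>Y\<^esub> ract Y \<xi> b"
    and ract_smult_left: "\<lbrakk>\<xi> \<in> carrier Y; a \<in> carrier A\<rbrakk>
          \<Longrightarrow> ract Y (c \<odot>\<^bsub>Y\<^esub> \<xi>) a = c \<odot>\<^bsub>Y\<^esub> ract Y \<xi> a"
    and ract_smult_right: "\<lbrakk>\<xi> \<in> carrier Y; a \<in> carrier A\<rbrakk>
          \<Longrightarrow> ract Y \<xi> (c \<odot>\<^bsub>A\<^esub> a) = c \<odot>\<^bsub>Y\<^esub> ract Y \<xi> a"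
    and ract_mult: "\<lbrakk>\<xi> \<in> carrier Y; a \<in> carrier A; b \<in> carrier A\<rbrakk>
          \<Longrightarrow> ract Y \<xi> (a \<otimes>\<^bsub>A\<^esub> b) = ract Y (ract Y \<xi> a) b"
    and inner_closed: "\<lbrakk>\<xi> \<in> carrier Y; \<eta> \<in> carrier Y\<rbrakk> \<Longrightarrow> ip Y \<xi> \<eta> \<in> carrier A"
    and inner_add: "\<lbrakk>\<xi> \<in> carrier Y; \<eta> \<in> carrier Y; \<zeta> \<in> carrier Y\<rbrakk>
          \<Longrightarrow> ip Y \<xi> (\<eta> \<oplus>\<^bsub>Y\<^esub> \<zeta>) = ip Y \<xi> \<eta> \<oplus>\<^bsub>A\<^esub> ip Y \<xi> \<zeta>"
    and inner_smult: "\<lbrakk>\<xi> \<in> carrier Y; \<eta> \<in> carrier Y\<rbrakk>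
          \<Longrightarrow> ip Y \<xi> (c \<odot>\<^bsub>Y\<^esub> \<eta>) = c \<odot>\<^bsub>A\<^esub> ip Y \<xi> \<eta>"
    and inner_ract: "\<lbrakk>\<xi> \<in> carrier Y; \<eta> \<in> carrier Y; a \<in> carrier A\<rbrakk>
          \<Longrightarrow> ip Y \<xi> (ract Y \<eta> a) = ip Y \<xi> \<eta> \<otimes>\<^bsub>A\<^esub> a"
    and inner_star: "\<lbrakk>\<xi> \<in> carrier Y; \<eta> \<in> carrier Y\<rbrakk> \<Longrightarrow> ip Y \<eta> \<xi> = star A (ip Y \<xi> \<eta>)"
    and inner_positive: "\<xi> \<in> carrier Y \<Longrightarrow> positive A (ip Y \<xi> \<xi>)"
    and inner_definite: "\<lbrakk>\<xi> \<in> carrier Y; ip Y \<xi> \<xi> = \<zero>\<^bsub>A\<^esub>\<rbrakk> \<Longrightarrow> \<xi> = \<zero>\<^bsub>Y\<^esub>"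
    and complete: "complete_on Y (hnorm A Y)"

definition adjointable ::
    "('a, 'x) bimod \<Rightarrow> ('a, 'y) bimod \<Rightarrow> ('x \<Rightarrow> 'y) \<Rightarrow> bool" where
  "adjointable Y Z T \<longleftrightarrow>
     T \<in> carrier Y \<rightarrow>\<^sub>E carrier Z \<and>
     (\<exists>S \<in> carrier Z \<rightarrow> carrier Y.
        \<forall>\<xi>\<in>carrier Y. \<forall>\<eta>\<in>carrier Z. ip Z (T \<xi>) \<eta> = ip Y \<xi> (S \<eta>))"

definition adjoint_op ::
    "('a, 'x) bimod \<Rightarrow> ('a, 'y) bimod \<Rightarrow> ('x \<Rightarrow> 'y) \<Rightarrow> 'y \<Rightarrow> 'x" where
  "adjoint_op Y Z T = (\<lambda>\<eta>\<in>carrier Z.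
     THE \<zeta>. \<zeta> \<in> carrier Y \<and> (\<forall>\<xi>\<in>carrier Y. ip Z (T \<xi>) \<eta> = ip Y \<xi> \<zeta>))"

text \<open>The C*-algebra of adjointable operators. Operators are extensional functions on the
  carrier, so that equal operators are equal as functions.\<close>

definition adjointables :: "'a cstar \<Rightarrow> ('a, 'x) bimod \<Rightarrow> ('x \<Rightarrow> 'x) cstar" where
  "adjointables A Y = \<lparr>
     carrier = {T. adjointable Y Y T},
     mult = compose (carrier Y),
     one = (\<lambda>\<xi>\<in>carrier Y. \<xi>),
     zero = (\<lambda>\<xi>\<in>carrier Y. \<zero>\<^bsub>Y\<^esub>),
     add = (\<lambda>S T. \<lambda>\<xi>\<in>carrier Y. S \<xi> \<oplus>\<^bsub>Y\<^esub> T \<xi>),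
     smult = (\<lambda>c T. \<lambda>\<xi>\<in>carrier Y. c \<odot>\<^bsub>Y\<^esub> T \<xi>),
     star = adjoint_op Y Y,
     cnorm = (\<lambda>T. SUP \<xi>\<in>{\<xi> \<in> carrier Y. hnorm A Y \<xi> \<le> 1}. hnorm A Y (T \<xi>))\<rparr>"

definition left_op :: "('a, 'x) bimod \<Rightarrow> 'a \<Rightarrow> 'x \<Rightarrow> 'x" where
  "left_op Y a = (\<lambda>\<xi>\<in>carrier Y. lact Y a \<xi>)"

locale hilbert_bimodule = hilbert_module +
  assumes left_action: "star_hom A (adjointables A Y) (left_op Y)"

definition theta :: "('a, 'x) bimod \<Rightarrow> 'x \<Rightarrow> 'x \<Rightarrow> 'x \<Rightarrow> 'x" where
  "theta Y \<xi> \<eta> = (\<lambda>\<zeta>\<in>carrier Y. ract Y \<xi> (ip Y \<eta> \<zeta>))"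

definition compacts :: "'a cstar \<Rightarrow> ('a, 'x) bimod \<Rightarrow> ('x \<Rightarrow> 'x) cstar" where
  "compacts A Y = (adjointables A Y)
     \<lparr>carrier := closed_span (adjointables A Y) {theta Y \<xi> \<eta> | \<xi> \<eta>. \<xi> \<in> carrier Y \<and> \<eta> \<in> carrier Y}\<rparr>"

definition bimod_iso ::
    "'a cstar \<Rightarrow> ('a, 'x) bimod \<Rightarrow> ('a, 'y) bimod \<Rightarrow> ('x \<Rightarrow> 'y) \<Rightarrow> bool" where
  "bimod_iso A Y Z f \<longleftrightarrow>
     bij_betw f (carrier Y) (carrier Z) \<and> linear_on Y Z f \<and>
     (\<forall>\<xi>\<in>carrier Y. \<forall>\<eta>\<in>carrier Y. ip Z (f \<xi>) (f \<eta>) = ip Y \<xi> \<eta>) \<and>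
     (\<forall>\<xi>\<in>carrier Y. \<forall>a\<in>carrier A. f (ract Y \<xi> a) = ract Z (f \<xi>) a \<and> f (lact Y a \<xi>) = lact Z a (f \<xi>))"

definition self_bimod :: "'a cstar \<Rightarrow> ('a, 'a) bimod" where
  "self_bimod A = \<lparr>
     carrier = carrier A, mult = mult A, one = one A, zero = zero A, add = add A, smult = smult A,
     ract = mult A, lact = mult A, ip = (\<lambda>a b. star A a \<otimes>\<^bsub>A\<^esub> b)\<rparr>"

section \<open>The balanced tensor product\<close>

text \<open>The tensor product of \<open>Y\<close> and \<open>Z\<close> over \<open>A\<close> is the separated completion of the space of
  formal sums of elementary tensors, with respect to the seminorm given by the (degenerate)
  \<open>A\<close>-valued inner product. A formal sum \<open>\<Sum>\<^sub>i \<xi>\<^sub>i \<otimes> \<eta>\<^sub>i\<close> is the list of the pairs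
  \<open>(\<xi>\<^sub>i, \<eta>\<^sub>i)\<close>; elements of the tensor product are classes of Cauchy sequences of such sums.
  Bilinearity and \<open>A\<close>-balancedness need not be imposed separately, because the respective
  differences have seminorm zero.\<close>

definition formal_inner ::
    "'a cstar \<Rightarrow> ('a, 'x) bimod \<Rightarrow> ('a, 'y) bimod \<Rightarrow> ('x \<times> 'y) list \<Rightarrow> ('x \<times> 'y) list \<Rightarrow> 'a" where
  "formal_inner A Y Z u v =
     foldr (\<lambda>((\<xi>1, \<eta>1), (\<xi>2, \<eta>2)) t. ip Z (lact Z (ip Y \<xi>2 \<xi>1) \<eta>1) \<eta>2 \<oplus>\<^bsub>A\<^esub> t)
       (List.product u v) \<zero>\<^bsub>A\<^esub>"

definition formal_dist ::
    "'a cstar \<Rightarrow> ('a, 'x) bimod \<Rightarrow> ('a, 'y) bimod \<Rightarrow> ('x \<times> 'y) list \<Rightarrow> ('x \<times> 'y) list \<Rightarrow> real" where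
  "formal_dist A Y Z u v =
     (let w = u @ map (\<lambda>(\<xi>, \<eta>). (\<ominus>\<^bsub>Y\<^esub> \<xi>, \<eta>)) v in sqrt (cnorm A (formal_inner A Y Z w w)))"

definition formal_cauchy ::
    "'a cstar \<Rightarrow> ('a, 'x) bimod \<Rightarrow> ('a, 'y) bimod \<Rightarrow> (nat \<Rightarrow> ('x \<times> 'y) list) set" where
  "formal_cauchy A Y Z =
     {u. (\<forall>n. set (u n) \<subseteq> carrier Y \<times> carrier Z) \<and>
         (\<forall>\<epsilon>>0. \<exists>M. \<forall>m\<ge>M. \<forall>n\<ge>M. formal_dist A Y Z (u m) (u n) < \<epsilon>)}"

definition formal_equiv ::
    "'a cstar \<Rightarrow> ('a, 'x) bimod \<Rightarrow> ('a, 'y) bimod \<Rightarrow>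
     ((nat \<Rightarrow> ('x \<times> 'y) list) \<times> (nat \<Rightarrow> ('x \<times> 'y) list)) set" where
  "formal_equiv A Y Z =
     {(u, v). u \<in> formal_cauchy A Y Z \<and> v \<in> formal_cauchy A Y Z \<and>
              (\<lambda>n. formal_dist A Y Z (u n) (v n)) \<longlonglongrightarrow> 0}"

type_synonym ('x, 'y) tens = "(nat \<Rightarrow> ('x \<times> 'y) list) set"

text \<open>The operator \<open>\<Sum>\<^sub>i \<xi>\<^sub>i \<otimes> \<eta>\<^sub>i \<mapsto> \<Sum>\<^sub>i f (\<xi>\<^sub>i) \<otimes> g (\<eta>\<^sub>i)\<close>; it is only used for \<open>f\<close>, \<open>g\<close> for which it
  is well defined on classes.\<close>

definition tensor_map ::
    "'a cstar \<Rightarrow> ('a, 'x) bimod \<Rightarrow> ('a, 'y) bimod \<Rightarrow> ('x \<Rightarrow> 'x) \<Rightarrow> ('y \<Rightarrow> 'y) \<Rightarrow>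
     ('x, 'y) tens \<Rightarrow> ('x, 'y) tens" where
  "tensor_map A Y Z f g U = (\<Union>u\<in>U. formal_equiv A Y Z `` {\<lambda>n. map (map_prod f g) (u n)})"

definition elem_tensor ::
    "'a cstar \<Rightarrow> ('a, 'x) bimod \<Rightarrow> ('a, 'y) bimod \<Rightarrow> 'x \<Rightarrow> 'y \<Rightarrow> ('x, 'y) tens" where
  "elem_tensor A Y Z \<xi> \<eta> = formal_equiv A Y Z `` {\<lambda>n. [(\<xi>, \<eta>)]}"

definition tensor ::
    "'a cstar \<Rightarrow> ('a, 'x) bimod \<Rightarrow> ('a, 'y) bimod \<Rightarrow> ('a, ('x, 'y) tens) bimod" where
  "tensor A Y Z = \<lparr>
     carrier = formal_cauchy A Y Z // formal_equiv A Y Z,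
     mult = undefined,
     one = undefined,
     zero = formal_equiv A Y Z `` {\<lambda>n. []},
     add = (\<lambda>U V. \<Union>u\<in>U. \<Union>v\<in>V. formal_equiv A Y Z `` {\<lambda>n. u n @ v n}),
     smult = (\<lambda>c. tensor_map A Y Z (\<lambda>\<xi>. c \<odot>\<^bsub>Y\<^esub> \<xi>) (\<lambda>\<eta>. \<eta>)),
     ract = (\<lambda>U b. tensor_map A Y Z (\<lambda>\<xi>. \<xi>) (\<lambda>\<eta>. ract Z \<eta> b) U),
     lact = (\<lambda>a. tensor_map A Y Z (lact Y a) (\<lambda>\<eta>. \<eta>)),
     ip = (\<lambda>U V. THE a. a \<in> carrier A \<and>
        (\<forall>u\<in>U. \<forall>v\<in>V. (\<lambda>n. cnorm A (formal_inner A Y Z (u n) (v n) \<ominus>\<^bsub>A\<^esub> a)) \<longlonglongrightarrow> 0))\<rparr>"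

section \<open>Lattice ordered groups\<close>

definition pos_le :: "'g monoid \<Rightarrow> 'g set \<Rightarrow> 'g \<Rightarrow> 'g \<Rightarrow> bool" where
  "pos_le G P s r \<longleftrightarrow> inv\<^bsub>G\<^esub> s \<otimes>\<^bsub>G\<^esub> r \<in> P"

definition is_join :: "'g monoid \<Rightarrow> 'g set \<Rightarrow> 'g \<Rightarrow> 'g \<Rightarrow> 'g \<Rightarrow> bool" where
  "is_join G P s r u \<longleftrightarrow>
     u \<in> carrier G \<and> pos_le G P s u \<and> pos_le G P r u \<and>
     (\<forall>v\<in>carrier G. pos_le G P s v \<and> pos_le G P r v \<longrightarrow> pos_le G P u v)"

definition join :: "'g monoid \<Rightarrow> 'g set \<Rightarrow> 'g \<Rightarrow> 'g \<Rightarrow> 'g" where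
  "join G P s r = (THE u. is_join G P s r u)"

definition lattice_ordered_group :: "'g monoid \<Rightarrow> 'g set \<Rightarrow> bool" where
  "lattice_ordered_group G P \<longleftrightarrow>
     comm_group G \<and> submonoid P G \<and>
     carrier G = {p \<otimes>\<^bsub>G\<^esub> inv\<^bsub>G\<^esub> q | p q. p \<in> P \<and> q \<in> P} \<and>
     P \<inter> (\<lambda>p. inv\<^bsub>G\<^esub> p) ` P = {\<one>\<^bsub>G\<^esub>} \<and>
     (\<forall>s\<in>carrier G. \<forall>r\<in>carrier G. \<exists>u. is_join G P s r u)"

section \<open>Product systems\<close>

text \<open>The fibres \<open>X s\<close> (for \<open>s \<in> P\<close>) live in one common type, which contains the coefficient algebra
  as well, so that \<open>X e\<close> can be literally the bimodule \<open>A\<close>; the carriers may overlap, and the disjoint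
  union of the fibres is the set of pairs of an index and a vector. The product of
  \<open>\<xi> \<in> X s\<close> and \<open>\<eta> \<in> X r\<close> is \<open>mul s r \<xi> \<eta> \<in> X (s r)\<close>.\<close>

type_synonym ('g, 'a) fibres = "'g \<Rightarrow> ('a, 'a) bimod"
type_synonym ('g, 'a) fibre_mult = "'g \<Rightarrow> 'g \<Rightarrow> 'a \<Rightarrow> 'a \<Rightarrow> 'a"

definition is_mult_iso ::
    "'a cstar \<Rightarrow> 'g monoid \<Rightarrow> ('g, 'a) fibres \<Rightarrow> ('g, 'a) fibre_mult \<Rightarrow> 'g \<Rightarrow> 'g \<Rightarrow>
     (('a, 'a) tens \<Rightarrow> 'a) \<Rightarrow> bool" where
  "is_mult_iso A G X mul s r F \<longleftrightarrow>
     F \<in> extensional (carrier (tensor A (X s) (X r))) \<and>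
     bimod_iso A (tensor A (X s) (X r)) (X (s \<otimes>\<^bsub>G\<^esub> r)) F \<and>
     (\<forall>\<xi>\<in>carrier (X s). \<forall>\<eta>\<in>carrier (X r). F (elem_tensor A (X s) (X r) \<xi> \<eta>) = mul s r \<xi> \<eta>)"

text \<open>The map \<open>F\<^sup>s\<^sup>,\<^sup>r\<close>, for \<open>s, r \<noteq> e\<close>.\<close>

definition mult_iso ::
    "'a cstar \<Rightarrow> 'g monoid \<Rightarrow> ('g, 'a) fibres \<Rightarrow> ('g, 'a) fibre_mult \<Rightarrow> 'g \<Rightarrow> 'g \<Rightarrow>
     ('a, 'a) tens \<Rightarrow> 'a" where
  "mult_iso A G X mul s r = (THE F. is_mult_iso A G X mul s r F)"

locale product_system =
  fixes A :: "'a cstar" and G :: "'g monoid" and P :: "'g set"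
    and X :: "('g, 'a) fibres" and mul :: "('g, 'a) fibre_mult"
  assumes lattice_ordered: "lattice_ordered_group G P"
    and coefficients: "unital_cstar_algebra A"
    and fibre: "s \<in> P \<Longrightarrow> hilbert_bimodule A (X s)"
    and fibre_unit: "X \<one>\<^bsub>G\<^esub> = self_bimod A"
    and mul_closed: "\<lbrakk>s \<in> P; r \<in> P; \<xi> \<in> carrier (X s); \<eta> \<in> carrier (X r)\<rbrakk>
          \<Longrightarrow> mul s r \<xi> \<eta> \<in> carrier (X (s \<otimes>\<^bsub>G\<^esub> r))"
    and mul_assoc: "\<lbrakk>s \<in> P; r \<in> P; t \<in> P;
            \<xi> \<in> carrier (X s); \<eta> \<in> carrier (X r); \<zeta> \<in> carrier (X t)\<rbrakk>
          \<Longrightarrow> mul (s \<otimes>\<^bsub>G\<^esub> r) t (mul s r \<xi> \<eta>) \<zeta> = mul s (r \<otimes>\<^bsub>G\<^esub> t) \<xi> (mul r t \<eta> \<zeta>)"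
    and mul_unit_left: "\<lbrakk>s \<in> P; a \<in> carrier A; \<xi> \<in> carrier (X s)\<rbrakk>
          \<Longrightarrow> mul \<one>\<^bsub>G\<^esub> s a \<xi> = lact (X s) a \<xi>"
    and mul_unit_right: "\<lbrakk>s \<in> P; a \<in> carrier A; \<xi> \<in> carrier (X s)\<rbrakk>
          \<Longrightarrow> mul s \<one>\<^bsub>G\<^esub> \<xi> a = ract (X s) \<xi> a"
    and mul_iso: "\<lbrakk>s \<in> P; r \<in> P; s \<noteq> \<one>\<^bsub>G\<^esub>; r \<noteq> \<one>\<^bsub>G\<^esub>\<rbrakk> \<Longrightarrow> \<exists>F. is_mult_iso A G X mul s r F"

text \<open>The map \<open>i\<^sub>s\<^sup>s\<^sup>r\<close>. An adjointable operator on \<open>X e = A\<close> is left multiplication by its value at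
  \<open>1\<close>; the case \<open>s = e\<close> is \<open>\<phi>\<^sub>r\<close> under this identification of operators on \<open>X e\<close> with elements
  of \<open>A\<close>.\<close>

definition iota ::
    "'a cstar \<Rightarrow> 'g monoid \<Rightarrow> ('g, 'a) fibres \<Rightarrow> ('g, 'a) fibre_mult \<Rightarrow> 'g \<Rightarrow> 'g \<Rightarrow>
     ('a \<Rightarrow> 'a) \<Rightarrow> 'a \<Rightarrow> 'a" where
  "iota A G X mul s r S =
     (if r = \<one>\<^bsub>G\<^esub> then S
      else if s = \<one>\<^bsub>G\<^esub> then left_op (X r) (S \<one>\<^bsub>A\<^esub>)
      else (\<lambda>\<zeta>\<in>carrier (X (s \<otimes>\<^bsub>G\<^esub> r)).
        mult_iso A G X mul s r
          (tensor_map A (X s) (X r) S (\<lambda>\<eta>. \<eta>)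
            (adjoint_op (tensor A (X s) (X r)) (X (s \<otimes>\<^bsub>G\<^esub> r)) (mult_iso A G X mul s r) \<zeta>))))"

text \<open>The operator \<open>i\<^sub>s\<^sup>u(S)\<close> for \<open>s \<le> u\<close>.\<close>

definition iota_to ::
    "'a cstar \<Rightarrow> 'g monoid \<Rightarrow> ('g, 'a) fibres \<Rightarrow> ('g, 'a) fibre_mult \<Rightarrow> 'g \<Rightarrow> 'g \<Rightarrow>
     ('a \<Rightarrow> 'a) \<Rightarrow> 'a \<Rightarrow> 'a" where
  "iota_to A G X mul s u = iota A G X mul s (inv\<^bsub>G\<^esub> s \<otimes>\<^bsub>G\<^esub> u)"

definition join_prod ::
    "'a cstar \<Rightarrow> 'g monoid \<Rightarrow> 'g set \<Rightarrow> ('g, 'a) fibres \<Rightarrow> ('g, 'a) fibre_mult \<Rightarrow> 'g \<Rightarrow> 'g \<Rightarrow>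
     ('a \<Rightarrow> 'a) \<Rightarrow> ('a \<Rightarrow> 'a) \<Rightarrow> 'a \<Rightarrow> 'a" where
  "join_prod A G P X mul s r S T =
     (let u = join G P s r in
      iota_to A G X mul s u S \<otimes>\<^bsub>adjointables A (X u)\<^esub> iota_to A G X mul r u T)"

definition compactly_aligned ::
    "'a cstar \<Rightarrow> 'g monoid \<Rightarrow> 'g set \<Rightarrow> ('g, 'a) fibres \<Rightarrow> ('g, 'a) fibre_mult \<Rightarrow> bool" where
  "compactly_aligned A G P X mul \<longleftrightarrow>
     (\<forall>s\<in>P. \<forall>r\<in>P. \<forall>S\<in>carrier (compacts A (X s)). \<forall>T\<in>carrier (compacts A (X r)).
        join_prod A G P X mul s r S T \<in> carrier (compacts A (X (join G P s r))))"

text \<open>\<open>n s\<close> is \<open>N\<^sub>s\<close> and \<open>v s j\<close> is \<open>1\<^sup>s\<^sub>j\<close>. In the last condition \<open>F\<^sup>s\<^sup>,\<^sup>r(\<xi> \<otimes> \<eta>)\<close> is the product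
  of \<open>\<xi>\<close> and \<open>\<eta>\<close>, also if \<open>s\<close> or \<open>r\<close> is the identity.\<close>

definition finite_type ::
    "'a cstar \<Rightarrow> 'g monoid \<Rightarrow> 'g set \<Rightarrow> ('g, 'a) fibres \<Rightarrow> ('g, 'a) fibre_mult \<Rightarrow>
     ('g \<Rightarrow> nat) \<Rightarrow> ('g \<Rightarrow> nat \<Rightarrow> 'a) \<Rightarrow> bool" where
  "finite_type A G P X mul n v \<longleftrightarrow>
     (\<forall>s\<in>P. 1 \<le> n s \<and> (\<forall>j<n s. v s j \<in> carrier (X s)) \<and>
        carrier (X s) =
          {finsum (X s) (\<lambda>j. lact (X s) (a j) (v s j)) {..<n s} | a. a \<in> {..<n s} \<rightarrow> carrier A} \<and>
        carrier (X s) =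
          {finsum (X s) (\<lambda>j. ract (X s) (v s j) (b j)) {..<n s} | b. b \<in> {..<n s} \<rightarrow> carrier A} \<and>
        (\<forall>j<n s. \<forall>k<n s. ip (X s) (v s j) (v s k) = (if j = k then \<one>\<^bsub>A\<^esub> else \<zero>\<^bsub>A\<^esub>))) \<and>
     (\<forall>s\<in>P. \<forall>r\<in>P. \<exists>m :: nat \<times> nat \<Rightarrow> nat.
        m \<in> {..<n s} \<times> {..<n r} \<rightarrow> {..<n (s \<otimes>\<^bsub>G\<^esub> r)} \<and>
        (\<forall>j<n s. \<forall>k<n r. mul s r (v s j) (v r k) = v (s \<otimes>\<^bsub>G\<^esub> r) (m (j, k))))"

section \<open>Nica covariant Toeplitz representations\<close>

definition toeplitz_rep ::
    "'a cstar \<Rightarrow> 'g monoid \<Rightarrow> 'g set \<Rightarrow> ('g, 'a) fibres \<Rightarrow> ('g, 'a) fibre_mult \<Rightarrow>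
     'c cstar \<Rightarrow> ('g \<Rightarrow> 'a \<Rightarrow> 'c) \<Rightarrow> bool" where
  "toeplitz_rep A G P X mul C \<psi> \<longleftrightarrow>
     (\<forall>s\<in>P. linear_on (X s) C (\<psi> s)) \<and>
     star_hom A C (\<psi> \<one>\<^bsub>G\<^esub>) \<and>
     (\<forall>s\<in>P. \<forall>r\<in>P. \<forall>\<xi>\<in>carrier (X s). \<forall>\<eta>\<in>carrier (X r).
        \<psi> s \<xi> \<otimes>\<^bsub>C\<^esub> \<psi> r \<eta> = \<psi> (s \<otimes>\<^bsub>G\<^esub> r) (mul s r \<xi> \<eta>)) \<and>
     (\<forall>s\<in>P. \<forall>\<xi>\<in>carrier (X s). \<forall>\<eta>\<in>carrier (X s).
        star C (\<psi> s \<xi>) \<otimes>\<^bsub>C\<^esub> \<psi> s \<eta> = \<psi> \<one>\<^bsub>G\<^esub> (ip (X s) \<xi> \<eta>))"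

text \<open>\<open>\<Psi> s\<close> is the induced *-homomorphism \<open>\<psi>\<^sup>(\<^sup>s\<^sup>)\<close>; it is determined on the compact operators by its
  values on the operators \<open>\<theta>\<^sub>\<xi>\<^sub>,\<^sub>\<eta>\<close>.\<close>

definition induced_on_compacts ::
    "'a cstar \<Rightarrow> 'g set \<Rightarrow> ('g, 'a) fibres \<Rightarrow> 'c cstar \<Rightarrow> ('g \<Rightarrow> 'a \<Rightarrow> 'c) \<Rightarrow>
     ('g \<Rightarrow> ('a \<Rightarrow> 'a) \<Rightarrow> 'c) \<Rightarrow> bool" where
  "induced_on_compacts A P X C \<psi> \<Psi> \<longleftrightarrow>
     (\<forall>s\<in>P. star_hom (compacts A (X s)) C (\<Psi> s) \<and>
        (\<forall>\<xi>\<in>carrier (X s). \<forall>\<eta>\<in>carrier (X s).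
           \<Psi> s (theta (X s) \<xi> \<eta>) = \<psi> s \<xi> \<otimes>\<^bsub>C\<^esub> star C (\<psi> s \<eta>)))"

definition nica_rep ::
    "'a cstar \<Rightarrow> 'g monoid \<Rightarrow> 'g set \<Rightarrow> ('g, 'a) fibres \<Rightarrow> ('g, 'a) fibre_mult \<Rightarrow>
     'c cstar \<Rightarrow> ('g \<Rightarrow> 'a \<Rightarrow> 'c) \<Rightarrow> bool" where
  "nica_rep A G P X mul C \<psi> \<longleftrightarrow>
     toeplitz_rep A G P X mul C \<psi> \<and>
     (\<exists>\<Psi>. induced_on_compacts A P X C \<psi> \<Psi> \<and>
        (\<forall>s\<in>P. \<forall>r\<in>P. \<forall>S\<in>carrier (compacts A (X s)). \<forall>T\<in>carrier (compacts A (X r)).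
           \<Psi> s S \<otimes>\<^bsub>C\<^esub> \<Psi> r T = \<Psi> (join G P s r) (join_prod A G P X mul s r S T)))"

text \<open>\<open>C\<close>, \<open>i\<close> is the universal C*-algebra for Nica covariant Toeplitz representations.

  The test algebras \<open>D\<close> of the universal property range over all C*-algebras carried by sets of
  sequences in \<open>'g \<times> 'a\<close>. This is no loss of generality: a representation in any C*-algebra is one in
  the subalgebra that it generates; the rational combinations of words in the images of vectors and
  their adjoints are dense there, and there are at most as many of them as elements of \<open>'g \<times> 'a\<close>
  (unless \<open>A\<close>, hence the subalgebra, is zero), so the subalgebra has at most as many elements as
  there are such sequences and has an isomorphic copy of this kind.

  The description of \<open>C\<close> as the closed span of the elements \<open>i\<^sub>s(\<xi>) i\<^sub>r(\<eta>)\<^sup>*\<close>, which is a standard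
  consequence of Nica covariance and of being generated, is recorded as part of the definition.\<close>

definition nica_toeplitz_algebra ::
    "'a cstar \<Rightarrow> 'g monoid \<Rightarrow> 'g set \<Rightarrow> ('g, 'a) fibres \<Rightarrow> ('g, 'a) fibre_mult \<Rightarrow>
     'c cstar \<Rightarrow> ('g \<Rightarrow> 'a \<Rightarrow> 'c) \<Rightarrow> bool" where
  "nica_toeplitz_algebra A G P X mul C i \<longleftrightarrow>
     cstar_algebra C \<and> nica_rep A G P X mul C i \<and>
     generated_cstar C (\<Union>s\<in>P. i s ` carrier (X s)) = carrier C \<and>
     closed_span C {i s \<xi> \<otimes>\<^bsub>C\<^esub> star C (i r \<eta>) | s r \<xi> \<eta>.
       s \<in> P \<and> r \<in> P \<and> \<xi> \<in> carrier (X s) \<and> \<eta> \<in> carrier (X r)} = carrier C \<and>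
     (\<forall>(D :: (nat \<Rightarrow> 'g \<times> 'a) cstar) \<psi>. cstar_algebra D \<and> nica_rep A G P X mul D \<psi> \<longrightarrow>
        (\<exists>\<pi>. star_hom C D \<pi> \<and> (\<forall>s\<in>P. \<forall>\<xi>\<in>carrier (X s). \<pi> (i s \<xi>) = \<psi> s \<xi>)))"

definition core ::
    "'g set \<Rightarrow> ('g, 'a) fibres \<Rightarrow> 'c cstar \<Rightarrow> ('g \<Rightarrow> 'a \<Rightarrow> 'c) \<Rightarrow> 'c cstar" where
  "core P X C i = C\<lparr>carrier := closed_span C
     {i s \<xi> \<otimes>\<^bsub>C\<^esub> star C (i s \<eta>) | s \<xi> \<eta>. s \<in> P \<and> \<xi> \<in> carrier (X s) \<and> \<eta> \<in> carrier (X s)}\<rparr>"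

definition conditional_expectation :: "'c cstar \<Rightarrow> 'c cstar \<Rightarrow> ('c \<Rightarrow> 'c) \<Rightarrow> bool" where
  "conditional_expectation C B \<Phi> \<longleftrightarrow>
     linear_on C B \<Phi> \<and>
     (\<forall>y\<in>carrier B. \<Phi> y = y) \<and>
     (\<forall>c\<in>carrier C. cnorm B (\<Phi> c) \<le> cnorm C c) \<and>
     (\<forall>c\<in>carrier C. positive C c \<longrightarrow> positive B (\<Phi> c)) \<and>
     (\<forall>c\<in>carrier C. \<forall>y\<in>carrier B. \<Phi> (y \<otimes>\<^bsub>C\<^esub> c) = y \<otimes>\<^bsub>B\<^esub> \<Phi> c \<and> \<Phi> (c \<otimes>\<^bsub>C\<^esub> y) = \<Phi> c \<otimes>\<^bsub>B\<^esub> y)"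

definition core_expectation ::
    "'g set \<Rightarrow> ('g, 'a) fibres \<Rightarrow> 'c cstar \<Rightarrow> ('g \<Rightarrow> 'a \<Rightarrow> 'c) \<Rightarrow> ('c \<Rightarrow> 'c) \<Rightarrow> bool" where
  "core_expectation P X C i \<Phi> \<longleftrightarrow>
     conditional_expectation C (core P X C i) \<Phi> \<and>
     (\<forall>s\<in>P. \<forall>r\<in>P. \<forall>\<xi>\<in>carrier (X s). \<forall>\<eta>\<in>carrier (X r).
        \<Phi> (i s \<xi> \<otimes>\<^bsub>C\<^esub> star C (i r \<eta>)) = (if s = r then i s \<xi> \<otimes>\<^bsub>C\<^esub> star C (i s \<eta>) else \<zero>\<^bsub>C\<^esub>))"

section \<open>Dynamics, states and the KMS condition\<close>

definition cstar_dynamics :: "'c cstar \<Rightarrow> (real \<Rightarrow> 'c \<Rightarrow> 'c) \<Rightarrow> bool" where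
  "cstar_dynamics C \<sigma> \<longleftrightarrow>
     (\<forall>t. star_hom C C (\<sigma> t) \<and> bij_betw (\<sigma> t) (carrier C) (carrier C)) \<and>
     (\<forall>s t. \<forall>c\<in>carrier C. \<sigma> (s + t) c = \<sigma> s (\<sigma> t c)) \<and>
     (\<forall>c\<in>carrier C. \<forall>t. ((\<lambda>s. cnorm C (\<sigma> s c \<ominus>\<^bsub>C\<^esub> \<sigma> t c)) \<longlongrightarrow> 0) (at t))"

definition positive_reals_hom :: "'g monoid \<Rightarrow> ('g \<Rightarrow> real) \<Rightarrow> bool" where
  "positive_reals_hom G N \<longleftrightarrow>
     N \<in> carrier G \<rightarrow> {0<..} \<and> (\<forall>s\<in>carrier G. \<forall>r\<in>carrier G. N (s \<otimes>\<^bsub>G\<^esub> r) = N s * N r)"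

definition dynamics_from ::
    "'a cstar \<Rightarrow> 'g monoid \<Rightarrow> 'g set \<Rightarrow> ('g, 'a) fibres \<Rightarrow> 'c cstar \<Rightarrow> ('g \<Rightarrow> 'a \<Rightarrow> 'c) \<Rightarrow>
     ('g \<Rightarrow> real) \<Rightarrow> (real \<Rightarrow> 'c \<Rightarrow> 'c) \<Rightarrow> bool" where
  "dynamics_from A G P X C i N \<sigma> \<longleftrightarrow>
     cstar_dynamics C \<sigma> \<and>
     (\<forall>t. \<forall>a\<in>carrier A. \<sigma> t (i \<one>\<^bsub>G\<^esub> a) = i \<one>\<^bsub>G\<^esub> a) \<and>
     (\<forall>t. \<forall>s\<in>P. \<forall>\<xi>\<in>carrier (X s).
        \<sigma> t (i s \<xi>) = (complex_of_real (N s) powr (\<i> * complex_of_real t)) \<odot>\<^bsub>C\<^esub> i s \<xi>)"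

definition entire_on :: "'c cstar \<Rightarrow> (complex \<Rightarrow> 'c) \<Rightarrow> bool" where
  "entire_on C f \<longleftrightarrow>
     range f \<subseteq> carrier C \<and>
     (\<forall>z. \<exists>d\<in>carrier C.
        ((\<lambda>w. cnorm C (inverse (w - z) \<odot>\<^bsub>C\<^esub> (f w \<ominus>\<^bsub>C\<^esub> f z) \<ominus>\<^bsub>C\<^esub> d)) \<longlongrightarrow> 0) (at z))"

text \<open>\<open>f z\<close> is \<open>\<sigma>\<^sub>z(c)\<close>; it is determined by \<open>c\<close> because of the identity theorem.\<close>

definition entire_extension ::
    "'c cstar \<Rightarrow> (real \<Rightarrow> 'c \<Rightarrow> 'c) \<Rightarrow> 'c \<Rightarrow> (complex \<Rightarrow> 'c) \<Rightarrow> bool" where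
  "entire_extension C \<sigma> c f \<longleftrightarrow> entire_on C f \<and> (\<forall>t. f (complex_of_real t) = \<sigma> t c)"

definition analytic_element :: "'c cstar \<Rightarrow> (real \<Rightarrow> 'c \<Rightarrow> 'c) \<Rightarrow> 'c \<Rightarrow> bool" where
  "analytic_element C \<sigma> c \<longleftrightarrow> c \<in> carrier C \<and> (\<exists>f. entire_extension C \<sigma> c f)"

text \<open>A state is a positive linear functional of norm one.\<close>

definition state :: "'c cstar \<Rightarrow> ('c \<Rightarrow> complex) \<Rightarrow> bool" where
  "state C \<omega> \<longleftrightarrow>
     (\<forall>x\<in>carrier C. \<forall>y\<in>carrier C. \<omega> (x \<oplus>\<^bsub>C\<^esub> y) = \<omega> x + \<omega> y) \<and>
     (\<forall>c. \<forall>x\<in>carrier C. \<omega> (c \<odot>\<^bsub>C\<^esub> x) = c * \<omega> x) \<and>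
     (\<forall>x\<in>carrier C. positive C x \<longrightarrow> \<omega> x \<in> \<real> \<and> 0 \<le> Re (\<omega> x)) \<and>
     (\<forall>x\<in>carrier C. cmod (\<omega> x) \<le> cnorm C x) \<and>
     (\<forall>K. (\<forall>x\<in>carrier C. cmod (\<omega> x) \<le> K * cnorm C x) \<longrightarrow> 1 \<le> K)"

definition tracial_state :: "'c cstar \<Rightarrow> ('c \<Rightarrow> complex) \<Rightarrow> bool" where
  "tracial_state C \<omega> \<longleftrightarrow>
     state C \<omega> \<and> (\<forall>x\<in>carrier C. \<forall>y\<in>carrier C. \<omega> (x \<otimes>\<^bsub>C\<^esub> y) = \<omega> (y \<otimes>\<^bsub>C\<^esub> x))"

definition kms_state ::
    "'c cstar \<Rightarrow> (real \<Rightarrow> 'c \<Rightarrow> 'c) \<Rightarrow> real \<Rightarrow> ('c \<Rightarrow> complex) \<Rightarrow> bool" where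
  "kms_state C \<sigma> \<beta> \<omega> \<longleftrightarrow>
     state C \<omega> \<and>
     (\<forall>c d f. analytic_element C \<sigma> c \<and> analytic_element C \<sigma> d \<and> entire_extension C \<sigma> c f \<longrightarrow>
        \<omega> (c \<otimes>\<^bsub>C\<^esub> d) = \<omega> (d \<otimes>\<^bsub>C\<^esub> f (\<i> * complex_of_real \<beta>)))"

end

theory Submission
  imports Defs "HOL-Complex_Analysis.Conformal_Mappings"
begin

text \<open>Write \<open>\<omega> = \<phi> \<circ> \<Phi>\<close>. Since \<open>\<Phi>\<close> is a bimodule map over the core and \<open>\<phi>\<close> is a trace,
  \<open>\<omega> (y d) = \<omega> (d y)\<close> for \<open>y\<close> in the core and arbitrary \<open>d\<close>. The element \<open>S = i\<^sub>s(1\<^sup>s\<^sub>j)\<close> is an isometry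
  whose range projection lies in the core, and the scaling hypothesis extends by density to
  \<open>\<omega> (S x S\<^sup>*) = N(s)\<^sup>-\<^sup>\<beta> \<omega> (x)\<close> for all \<open>x\<close>. Hence
  \<open>\<omega> (S d) = \<omega> (S S\<^sup>* S d) = \<omega> (S d S S\<^sup>*) = N(s)\<^sup>-\<^sup>\<beta> \<omega> (d S)\<close>, and dually for \<open>S\<^sup>*\<close>. As the elements \<open>S\<close>
  and the coefficient algebra generate, every \<open>d = i\<^sub>p(\<xi>) i\<^sub>q(\<eta>)\<^sup>*\<close> satisfies
  \<open>\<omega> (d c) = (N(p)/N(q))\<^sup>-\<^sup>\<beta> \<omega> (c d)\<close> for all \<open>c\<close>.

  If \<open>f\<close> is the entire extension of \<open>t \<mapsto> \<sigma>\<^sub>t(c)\<close>, then invariance of \<open>\<omega>\<close> under \<open>\<sigma>\<close> gives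
  \<open>\<omega> (d f(t)) = (N(p)/N(q))\<^sup>-\<^sup>i\<^sup>t \<omega> (d c)\<close> for real \<open>t\<close>, hence for complex \<open>t\<close> by the identity theorem;
  \<open>t = i\<beta>\<close> is the KMS condition. Both of its sides are continuous in \<open>d\<close>, so it is enough to know it
  for such generators \<open>d\<close>.\<close>

section \<open>Complex vector spaces as modules\<close>

lemma complex_ring_simps [simp]:
  "carrier complex_ring = UNIV" "x \<otimes>\<^bsub>complex_ring\<^esub> y = x * y" "\<one>\<^bsub>complex_ring\<^esub> = 1"
  "\<zero>\<^bsub>complex_ring\<^esub> = 0" "x \<oplus>\<^bsub>complex_ring\<^esub> y = x + y"
  by (simp_all add: complex_ring_def)

text \<open>The module laws of the library speak of the operations of \<open>complex_ring\<close>;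
  they are recorded here in ordinary complex arithmetic. Negation as the scalar -1 lets later proofs
  treat differences as linear combinations.\<close>

lemma complex_space_smult:
  assumes "complex_space V" "x \<in> carrier V"
  shows "c \<odot>\<^bsub>V\<^esub> x \<in> carrier V"
    and "(c + d) \<odot>\<^bsub>V\<^esub> x = c \<odot>\<^bsub>V\<^esub> x \<oplus>\<^bsub>V\<^esub> d \<odot>\<^bsub>V\<^esub> x"
    and "y \<in> carrier V \<Longrightarrow> c \<odot>\<^bsub>V\<^esub> (x \<oplus>\<^bsub>V\<^esub> y) = c \<odot>\<^bsub>V\<^esub> x \<oplus>\<^bsub>V\<^esub> c \<odot>\<^bsub>V\<^esub> y"
    and "(c * d) \<odot>\<^bsub>V\<^esub> x = c \<odot>\<^bsub>V\<^esub> (d \<odot>\<^bsub>V\<^esub> x)"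
    and "1 \<odot>\<^bsub>V\<^esub> x = x"
    and "0 \<odot>\<^bsub>V\<^esub> x = \<zero>\<^bsub>V\<^esub>"
    and "(-1) \<odot>\<^bsub>V\<^esub> x = \<ominus>\<^bsub>V\<^esub> x"
proof -
  interpret module complex_ring V by fact
  show "c \<odot>\<^bsub>V\<^esub> x \<in> carrier V" using assms by simp
  show l: "(c + d) \<odot>\<^bsub>V\<^esub> x = c \<odot>\<^bsub>V\<^esub> x \<oplus>\<^bsub>V\<^esub> d \<odot>\<^bsub>V\<^esub> x" for c d
    using smult_l_distr[of c d x] assms by simp
  show "c \<odot>\<^bsub>V\<^esub> (x \<oplus>\<^bsub>V\<^esub> y) = c \<odot>\<^bsub>V\<^esub> x \<oplus>\<^bsub>V\<^esub> c \<odot>\<^bsub>V\<^esub> y" if "y \<in> carrier V"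
    using smult_r_distr[of c x y] assms that by simp
  show "(c * d) \<odot>\<^bsub>V\<^esub> x = c \<odot>\<^bsub>V\<^esub> (d \<odot>\<^bsub>V\<^esub> x)"
    using smult_assoc1[of c d x] assms by simp
  show one: "1 \<odot>\<^bsub>V\<^esub> x = x" using smult_one[of x] assms by simp
  show zero: "0 \<odot>\<^bsub>V\<^esub> x = \<zero>\<^bsub>V\<^esub>" using smult_l_null[of x] assms by simp
  have "(-1) \<odot>\<^bsub>V\<^esub> x \<oplus>\<^bsub>V\<^esub> x = \<zero>\<^bsub>V\<^esub>" using l[of "-1" 1] one zero by simp
  then show "(-1) \<odot>\<^bsub>V\<^esub> x = \<ominus>\<^bsub>V\<^esub> x"
    using assms by (intro M.minus_equality[symmetric]) auto
qed

text \<open>Only the additive structure is inherited from the library: a ring there has a unit,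
  which \<open>C\<close> need not have.\<close>

sublocale cstar_algebra \<subseteq> abelian_group C
  using complex_space by (rule module.axioms)

section \<open>Arithmetic and norm estimates in a C*-algebra\<close>

context cstar_algebra
begin

lemmas smult_simps = complex_space_smult[OF complex_space]

lemma smult_closed [simp]: "x \<in> carrier C \<Longrightarrow> c \<odot> x \<in> carrier C"
  by (simp add: smult_simps)

lemma smult_one [simp]: "x \<in> carrier C \<Longrightarrow> 1 \<odot> x = x"
  by (simp add: smult_simps)

lemma smult_zero_left [simp]: "x \<in> carrier C \<Longrightarrow> 0 \<odot> x = \<zero>"
  by (simp add: smult_simps)

lemma smult_minus_one: "x \<in> carrier C \<Longrightarrow> (-1) \<odot> x = \<ominus> x"
  by (simp add: smult_simps)

lemma diff_eq_smult: "x \<in> carrier C \<Longrightarrow> y \<in> carrier C \<Longrightarrow> x \<ominus> y = x \<oplus> (-1) \<odot> y"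
  by (simp add: smult_minus_one minus_eq)

declare mult_closed [simp] star_closed [simp] star_star [simp] norm_nonneg [simp]

lemma star_diff: "\<lbrakk>x \<in> carrier C; y \<in> carrier C\<rbrakk> \<Longrightarrow> star C (x \<ominus> y) = star C x \<ominus> star C y"
  by (simp add: diff_eq_smult star_add star_smult)

lemma mult_diff_right: "\<lbrakk>x \<in> carrier C; y \<in> carrier C; z \<in> carrier C\<rbrakk> \<Longrightarrow> z \<otimes> (x \<ominus> y) = z \<otimes> x \<ominus> z \<otimes> y"
  by (simp add: diff_eq_smult distr_right smult_mult_right)

lemma mult_diff_left: "\<lbrakk>x \<in> carrier C; y \<in> carrier C; z \<in> carrier C\<rbrakk> \<Longrightarrow> (x \<ominus> y) \<otimes> z = x \<otimes> z \<ominus> y \<otimes> z"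
  by (simp add: diff_eq_smult distr_left smult_mult_left)

lemma smult_diff: "\<lbrakk>x \<in> carrier C; y \<in> carrier C\<rbrakk> \<Longrightarrow> c \<odot> (x \<ominus> y) = c \<odot> x \<ominus> c \<odot> y"
  by (simp add: diff_eq_smult smult_simps(3) flip: smult_simps(4))

lemma diff_add_diff: "\<lbrakk>x \<in> carrier C; y \<in> carrier C; z \<in> carrier C\<rbrakk> \<Longrightarrow> (x \<ominus> y) \<oplus> (y \<ominus> z) = x \<ominus> z"
  by (simp add: minus_eq a_assoc r_neg1)

lemma add_diff_add:
  "\<lbrakk>z \<in> carrier C; x \<in> carrier C; y \<in> carrier C\<rbrakk> \<Longrightarrow> (z \<oplus> x) \<ominus> (z \<oplus> y) = x \<ominus> y"
  using a_lcomm[of z "\<ominus> y" "\<ominus> z"] by (simp add: minus_eq minus_add a_ac r_neg)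

lemma diff_self [simp]: "x \<in> carrier C \<Longrightarrow> x \<ominus> x = \<zero>"
  by (simp add: minus_eq r_neg)

lemma diff_eq_zero_iff:
  assumes "x \<in> carrier C" "y \<in> carrier C"
  shows "x \<ominus> y = \<zero> \<longleftrightarrow> x = y"
proof
  assume "x \<ominus> y = \<zero>"
  then have "(x \<ominus> y) \<oplus> y = y" using assms by simp
  then show "x = y" using assms by (simp add: minus_eq a_assoc l_neg)
qed (use assms in simp)

lemma norm_zero [simp]: "cnorm C \<zero> = 0"
  by (simp add: norm_zero_iff)

lemma norm_minus_commute:
  assumes "x \<in> carrier C" "y \<in> carrier C"
  shows "cnorm C (x \<ominus> y) = cnorm C (y \<ominus> x)"
proof -
  have "x \<ominus> y = (-1) \<odot> (y \<ominus> x)"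
    using assms by (simp add: diff_eq_smult smult_simps(3) a_comm flip: smult_simps(4))
  then show ?thesis using assms norm_smult[of "y \<ominus> x" "-1"] by simp
qed

lemma norm_diff_triangle:
  assumes "x \<in> carrier C" "y \<in> carrier C" "z \<in> carrier C"
  shows "cnorm C (x \<ominus> z) \<le> cnorm C (x \<ominus> y) + cnorm C (y \<ominus> z)"
  using norm_triangle[of "x \<ominus> y" "y \<ominus> z"] assms by (simp add: diff_add_diff)

lemma norm_le_add_diff:
  assumes "x \<in> carrier C" "y \<in> carrier C"
  shows "cnorm C x \<le> cnorm C y + cnorm C (x \<ominus> y)"
proof -
  have "x = y \<oplus> (x \<ominus> y)" using assms by (simp add: minus_eq a_lcomm r_neg)
  then show ?thesis using norm_triangle[of y "x \<ominus> y"] assms by simp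
qed

text \<open>The C*-identity and submultiplicativity bound the square of the norm of \<open>x\<close>
  by the product of the norms of \<open>star C x\<close> and \<open>x\<close>. Cancelling gives one
  inequality, and applying it to \<open>star C x\<close> gives the other.\<close>

lemma norm_star [simp]:
  assumes "x \<in> carrier C"
  shows "cnorm C (star C x) = cnorm C x"
proof -
  have le: "cnorm C x \<le> cnorm C (star C x)" if x: "x \<in> carrier C" for x
  proof (cases "cnorm C x = 0")
    case False
    have "cnorm C x * cnorm C x \<le> cnorm C (star C x) * cnorm C x"
      using cstar_identity[OF x] norm_mult[of "star C x" x] x by (simp add: power2_eq_square)
    with False norm_nonneg[OF x] show ?thesis by simp
  qed (use x in simp)
  from le[OF assms] le[of "star C x"] assms show ?thesis by simp
qed

section \<open>Closed spans and bounded functionals\<close>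

lemma closed_span_superset:
  assumes "S \<subseteq> carrier C"
  shows "S \<subseteq> closed_span C S"
proof
  fix x assume x: "x \<in> S"
  with assms have xC: "x \<in> carrier C" by blast
  have "\<zero> \<oplus> 1 \<odot> x \<in> lin_span C S" by (intro span_step span_zero x)
  then have "x \<in> lin_span C S" using xC by simp
  with xC show "x \<in> closed_span C S" unfolding closed_span_def norm_closure_def by force
qed

text \<open>A bounded seminorm is continuous, so its zero set is a closed subspace. A general
  \<open>p\<close> covers both the difference of two functionals and the defect of an element from
  being a unit.\<close>

lemma closed_span_seminorm_zero:
  assumes S: "S \<subseteq> carrier C" and x: "x \<in> closed_span C S"
    and add: "\<And>x y. \<lbrakk>x \<in> carrier C; y \<in> carrier C\<rbrakk> \<Longrightarrow> p (x \<oplus> y) \<le> p x + p y"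
    and smult: "\<And>c x. x \<in> carrier C \<Longrightarrow> p (c \<odot> x) = cmod c * p x"
    and nonneg: "\<And>x. x \<in> carrier C \<Longrightarrow> 0 \<le> p x"
    and bound: "\<And>x. x \<in> carrier C \<Longrightarrow> p x \<le> K * cnorm C x"
    and zero: "\<And>x. x \<in> S \<Longrightarrow> p x = 0"
  shows "p x = 0"
proof -
  have span: "y \<in> carrier C \<and> p y = 0" if "y \<in> lin_span C S" for y
    using that
  proof induction
    case span_zero
    show ?case using smult[of \<zero> 0] by simp
  next
    case (span_step x y c)
    then have "y \<in> carrier C" using S by blast
    with span_step add[of x "c \<odot> y"] nonneg[of "x \<oplus> c \<odot> y"] smult[of y c] zero[of y]
    show ?case by auto
  qed
  have xC: "x \<in> carrier C" using x by (simp add: closed_span_def norm_closure_def)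
  have "p x \<le> 0 + e" if "e > 0" for e
  proof -
    \<comment> \<open>\<open>K\<close> may be zero or negative, hence this positive replacement as a
      divisor.\<close>
    have K: "\<bar>K\<bar> + 1 > 0" by linarith
    obtain y where y: "y \<in> lin_span C S" "cnorm C (x \<ominus> y) < e / (\<bar>K\<bar> + 1)"
      using x divide_pos_pos[OF \<open>e > 0\<close> K] by (auto simp: closed_span_def norm_closure_def)
    have yC: "y \<in> carrier C" using span y by blast
    have "x = y \<oplus> (x \<ominus> y)" using xC yC by (simp add: minus_eq a_lcomm r_neg)
    then have "p x \<le> p y + p (x \<ominus> y)" using add[of y "x \<ominus> y"] xC yC by simp
    also have "\<dots> \<le> K * cnorm C (x \<ominus> y)" using bound span y xC yC by simp
    also have "\<dots> \<le> (\<bar>K\<bar> + 1) * cnorm C (x \<ominus> y)" using xC yC by (intro mult_right_mono) auto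
    also have "\<dots> \<le> e" using y(2) K by (simp add: field_simps)
    finally show ?thesis by simp
  qed
  then have "p x \<le> 0" by (rule field_le_epsilon)
  with nonneg[OF xC] show ?thesis by simp
qed

definition bounded_functional :: "('a \<Rightarrow> complex) \<Rightarrow> bool" where
  "bounded_functional f \<longleftrightarrow>
     (\<forall>x\<in>carrier C. \<forall>y\<in>carrier C. f (x \<oplus> y) = f x + f y) \<and>
     (\<forall>c. \<forall>x\<in>carrier C. f (c \<odot> x) = c * f x) \<and>
     (\<exists>K. \<forall>x\<in>carrier C. cmod (f x) \<le> K * cnorm C x)"

text \<open>The seminorm \<open>cmod (f x - g x)\<close> vanishes on \<open>S\<close>. This is the
  device that carries identities from generators to the whole algebra.\<close>

lemma bounded_functional_eq_on_closed_span:
  assumes f: "bounded_functional f" and g: "bounded_functional g"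
    and "S \<subseteq> carrier C" and eq: "\<And>x. x \<in> S \<Longrightarrow> f x = g x"
    and "x \<in> closed_span C S"
  shows "f x = g x"
proof -
  obtain K where K: "\<And>x. x \<in> carrier C \<Longrightarrow> cmod (f x) \<le> K * cnorm C x"
    using f unfolding bounded_functional_def by blast
  obtain L where L: "\<And>x. x \<in> carrier C \<Longrightarrow> cmod (g x) \<le> L * cnorm C x"
    using g unfolding bounded_functional_def by blast
  have "cmod (f x - g x) = 0"
  proof (rule closed_span_seminorm_zero[OF assms(3,5)])
    fix x y assume "x \<in> carrier C" "y \<in> carrier C"
    then have "f (x \<oplus> y) - g (x \<oplus> y) = (f x - g x) + (f y - g y)"
      using f g by (simp add: bounded_functional_def)
    then show "cmod (f (x \<oplus> y) - g (x \<oplus> y)) \<le> cmod (f x - g x) + cmod (f y - g y)"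
      by (metis norm_triangle_ineq)
  next
    fix c x assume "x \<in> carrier C"
    then have "f (c \<odot> x) - g (c \<odot> x) = c * (f x - g x)"
      using f g by (simp add: bounded_functional_def algebra_simps)
    then show "cmod (f (c \<odot> x) - g (c \<odot> x)) = cmod c * cmod (f x - g x)"
      by (metis Real_Vector_Spaces.norm_mult)
  next
    fix x assume "x \<in> carrier C"
    then show "cmod (f x - g x) \<le> (K + L) * cnorm C x"
      using K[of x] L[of x] norm_triangle_ineq4[of "f x" "g x"] by (simp add: algebra_simps)
  qed (use eq in auto)
  then show ?thesis by simp
qed

lemma bounded_functional_scale:
  assumes "bounded_functional f"
  shows "bounded_functional (\<lambda>x. c * f x)"
proof -
  obtain K where K: "\<And>x. x \<in> carrier C \<Longrightarrow> cmod (f x) \<le> K * cnorm C x"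
    using assms unfolding bounded_functional_def by blast
  have "cmod (c * f x) \<le> (cmod c * K) * cnorm C x" if "x \<in> carrier C" for x
    using mult_left_mono[OF K[OF that], of "cmod c"] by (simp add: Real_Vector_Spaces.norm_mult ac_simps)
  then have "\<exists>K. \<forall>x\<in>carrier C. cmod (c * f x) \<le> K * cnorm C x" by blast
  moreover have "c * f (x \<oplus> y) = c * f x + c * f y" if "x \<in> carrier C" "y \<in> carrier C" for x y
    using assms that by (simp add: bounded_functional_def algebra_simps)
  moreover have "c * f (b \<odot> x) = b * (c * f x)" if "x \<in> carrier C" for b x
    using assms that by (simp add: bounded_functional_def)
  ultimately show ?thesis unfolding bounded_functional_def by blast
qed

lemma bounded_functional_mult:
  assumes f: "bounded_functional f" and a: "a \<in> carrier C"
  shows "bounded_functional (\<lambda>x. f (a \<otimes> x))" "bounded_functional (\<lambda>x. f (x \<otimes> a))"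
proof -
  obtain K where K: "\<And>x. x \<in> carrier C \<Longrightarrow> cmod (f x) \<le> K * cnorm C x"
    using f unfolding bounded_functional_def by blast
  \<comment> \<open>One estimate serves both sides: \<open>y\<close> stands for
    \<open>a \<otimes> x\<close> or for \<open>x \<otimes> a\<close>.\<close>
  have *: "cmod (f y) \<le> (\<bar>K\<bar> * cnorm C a) * cnorm C x"
    if "y \<in> carrier C" "cnorm C y \<le> cnorm C a * cnorm C x" for x y
  proof -
    have "cmod (f y) \<le> \<bar>K\<bar> * cnorm C y"
      using K[OF that(1)] mult_right_mono[OF abs_ge_self[of K] norm_nonneg[OF that(1)]] by linarith
    also have "\<dots> \<le> \<bar>K\<bar> * (cnorm C a * cnorm C x)"
      using that by (intro mult_left_mono) auto
    finally show ?thesis by simp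
  qed
  show "bounded_functional (\<lambda>x. f (a \<otimes> x))"
    unfolding bounded_functional_def
    using f a by (auto simp: bounded_functional_def distr_right smult_mult_right
        intro!: exI[of _ "\<bar>K\<bar> * cnorm C a"] * norm_mult)
  have "cnorm C (x \<otimes> a) \<le> cnorm C a * cnorm C x" if "x \<in> carrier C" for x
    using norm_mult[OF that a] by (simp add: mult.commute)
  then show "bounded_functional (\<lambda>x. f (x \<otimes> a))"
    unfolding bounded_functional_def
    using f a by (auto simp: bounded_functional_def distr_left smult_mult_left
        intro!: exI[of _ "\<bar>K\<bar> * cnorm C a"] *)
qed

section \<open>Automatic continuity of positive functionals\<close>

text \<open>The fixed point equation says \<open>(1 - y)\<^sup>2 = 1 - h\<close>.\<close>

lemma hermitian_sqrt:
  assumes h: "h \<in> carrier C" "star C h = h" "cnorm C h \<le> 1/2"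
  obtains y where "y \<in> carrier C" "star C y = y" "y = (1/2) \<odot> h \<oplus> (1/2) \<odot> (y \<otimes> y)"
proof -
  \<comment> \<open>Banach's fixed point theorem is applied to \<open>T\<close> on this ball: the
    radius 1/2 makes \<open>T\<close> a self-map and a contraction with constant 1/2.\<close>
  define M where "M = {y \<in> carrier C. star C y = y \<and> cnorm C y \<le> 1/2}"
  \<comment> \<open>\<open>Metric_space\<close> demands nonnegativity and symmetry for all
    arguments, also outside \<open>M\<close>; the default value 0 provides them.\<close>
  define d where "d = (\<lambda>x y. if x \<in> carrier C \<and> y \<in> carrier C then cnorm C (x \<ominus> y) else 0)"
  define T where "T = (\<lambda>y. (1/2) \<odot> h \<oplus> (1/2) \<odot> (y \<otimes> y))"
  have MC: "y \<in> carrier C" if "y \<in> M" for y using that by (simp add: M_def)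
  interpret Metric_space M d
    by standard (auto simp: d_def M_def norm_minus_commute norm_zero_iff diff_eq_zero_iff
        intro: norm_diff_triangle)
  \<comment> \<open>Completeness of \<open>C\<close> supplies a limit; the norm bound and
    self-adjointness both pass to it, so it lies in \<open>M\<close>.\<close>
  have "mcomplete"
    unfolding mcomplete_def
  proof (intro allI impI)
    fix x assume x: "MCauchy x"
    then have xM: "x k \<in> M" for k by (auto simp: MCauchy_def)
    have "\<forall>e>0. \<exists>N. \<forall>m\<ge>N. \<forall>n\<ge>N. cnorm C (x m \<ominus> x n) < e"
    proof -
      have "d (x m) (x n) = cnorm C (x m \<ominus> x n)" for m n
        using MC[OF xM] by (simp add: d_def)
      with x show ?thesis unfolding MCauchy_def by metis
    qed
    then obtain l where l: "l \<in> carrier C" "(\<lambda>n. cnorm C (x n \<ominus> l)) \<longlonglongrightarrow> 0"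
      using complete xM MC unfolding complete_on_def by blast
    have "cnorm C l \<le> 1/2 + cnorm C (x k \<ominus> l)" for k
      using norm_le_add_diff[OF l(1), of "x k"] xM[of k] l(1) norm_minus_commute[of l "x k"]
      by (simp add: M_def)
    moreover have "(\<lambda>k. 1/2 + cnorm C (x k \<ominus> l)) \<longlonglongrightarrow> 1/2 + 0"
      by (intro tendsto_intros l)
    ultimately have "cnorm C l \<le> 1/2"
      using LIMSEQ_le_const[of "\<lambda>k. 1/2 + cnorm C (x k \<ominus> l)" "1/2"] by simp
    \<comment> \<open>The involution is isometric and fixes \<open>x k\<close>, so
      \<open>star C l\<close> and \<open>l\<close> are equally far from \<open>x k\<close>.\<close>
    moreover have "cnorm C (star C l \<ominus> l) \<le> 2 * cnorm C (x k \<ominus> l)" for k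
    proof -
      have "star C (l \<ominus> x k) = star C l \<ominus> x k"
        using xM[of k] l(1) by (simp add: M_def star_diff)
      then have "cnorm C (star C l \<ominus> x k) = cnorm C (x k \<ominus> l)"
        using norm_star[of "l \<ominus> x k"] MC[OF xM[of k]] l(1) by (simp add: norm_minus_commute)
      then show ?thesis
        using norm_diff_triangle[of "star C l" "x k" l] MC[OF xM[of k]] l(1) by simp
    qed
    then have "cnorm C (star C l \<ominus> l) \<le> 0"
      using LIMSEQ_le_const[OF tendsto_mult_right_zero[OF l(2), of 2]] by blast
    then have "star C l = l"
      using norm_zero_iff[of "star C l \<ominus> l"] norm_nonneg[of "star C l \<ominus> l"] l(1)
      by (simp add: diff_eq_zero_iff del: norm_nonneg)
    ultimately have lM: "l \<in> M" using l(1) by (simp add: M_def)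
    have "(\<lambda>n. d (x n) l) \<longlonglongrightarrow> 0"
      using l MC[OF xM] by (simp add: d_def)
    then show "\<exists>l. limitin mtopology x l sequentially"
      using lM xM by (auto simp: limitin_metric_dist_null)
  qed
  moreover have "M \<noteq> {}"
    using star_smult[of \<zero> 0] by (auto simp: M_def intro!: exI[of _ \<zero>])
  moreover have "T \<in> M \<rightarrow> M"
  proof
    fix y assume y: "y \<in> M"
    have "cnorm C (T y) \<le> cnorm C ((1/2) \<odot> h) + cnorm C ((1/2) \<odot> (y \<otimes> y))"
      unfolding T_def using y h by (intro norm_triangle) (auto simp: M_def)
    also have "\<dots> \<le> 1/2 * (1/2) + 1/2 * (1/2 * (1/2))"
    proof -
      have "cnorm C (y \<otimes> y) \<le> 1/2 * (1/2)"
        using y by (intro order.trans[OF norm_mult] mult_mono) (auto simp: M_def)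
      then show ?thesis using h MC[OF y] by (simp add: norm_smult)
    qed
    finally have "cnorm C (T y) \<le> 1/2" by simp
    then show "T y \<in> M" using h y by (simp add: M_def T_def star_add star_smult star_mult)
  qed
  moreover have "d (T y) (T z) \<le> 1/2 * d y z" if y: "y \<in> M" and z: "z \<in> M" for y z
  proof -
    note yz = MC[OF y] MC[OF z]
    have "T y \<ominus> T z = (1/2) \<odot> (y \<otimes> y \<ominus> z \<otimes> z)"
      using h yz by (simp add: T_def add_diff_add smult_diff)
    \<comment> \<open>A difference of squares that avoids commutativity; each summand contributes a
      factor 1/2 from the radius of the ball.\<close>
    moreover have "y \<otimes> y \<ominus> z \<otimes> z = y \<otimes> (y \<ominus> z) \<oplus> (y \<ominus> z) \<otimes> z"
      using yz by (simp add: mult_diff_left mult_diff_right diff_add_diff)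
    moreover have "cnorm C (y \<otimes> (y \<ominus> z) \<oplus> (y \<ominus> z) \<otimes> z) \<le> 1/2 * cnorm C (y \<ominus> z) + cnorm C (y \<ominus> z) * (1/2)"
      using y z yz by (intro order.trans[OF norm_triangle] add_mono order.trans[OF norm_mult] mult_mono)
        (auto simp: M_def)
    ultimately show ?thesis using yz h by (simp add: d_def norm_smult T_def)
  qed
  ultimately obtain y where "y \<in> M" "T y = y"
    by - (rule Banach_fixedpoint_thm[of T "1/2"], simp_all)
  then show thesis using that[of y] by (simp add: M_def T_def)
qed

text \<open>For a small self-adjoint \<open>h\<close> the element \<open>u \<ominus> h\<close> is a
  square by \<open>hermitian_sqrt\<close>, so positivity bounds \<open>f h\<close> by
  \<open>f u\<close>. Rescaling handles all self-adjoint elements, and real and imaginary parts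
  handle the rest. The unit \<open>u\<close> is a parameter because the locale does not provide
  one.\<close>

lemma positive_functional_bounded:
  assumes u: "u \<in> carrier C" "star C u = u" "\<And>x. x \<in> carrier C \<Longrightarrow> u \<otimes> x = x"
      "\<And>x. x \<in> carrier C \<Longrightarrow> x \<otimes> u = x"
    and add: "\<And>x y. \<lbrakk>x \<in> carrier C; y \<in> carrier C\<rbrakk> \<Longrightarrow> f (x \<oplus> y) = f x + f y"
    and smult: "\<And>c x. x \<in> carrier C \<Longrightarrow> f (c \<odot> x) = c * f x"
    and pos: "\<And>x. x \<in> carrier C \<Longrightarrow> f (star C x \<otimes> x) \<in> \<real> \<and> 0 \<le> Re (f (star C x \<otimes> x))"
  shows "bounded_functional f"
proof -
  define r where "r = Re (f u)"
  have fu: "f u = of_real r" "0 \<le> r"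
    using pos[of u] u by (auto simp: r_def complex_is_Real_iff complex_eq_iff)
  have below: "f h \<in> \<real> \<and> Re (f h) \<le> r"
    if h: "h \<in> carrier C" "star C h = h" "cnorm C h \<le> 1/2" for h
  proof -
    obtain y where y: "y \<in> carrier C" "star C y = y" "y = (1/2) \<odot> h \<oplus> (1/2) \<odot> (y \<otimes> y)"
      using hermitian_sqrt[OF h] .
    \<comment> \<open>A self-adjoint square root of \<open>u \<ominus> h\<close>, because
      \<open>2y = h + yy\<close>.\<close>
    define w where "w = u \<oplus> (-1) \<odot> y"
    have "star C w \<otimes> w = (u \<oplus> (-1) \<odot> y) \<oplus> (-1) \<odot> (y \<oplus> (-1) \<odot> (y \<otimes> y))"
      using u y(1,2) unfolding w_def
      by (simp add: star_add star_smult distr_left distr_right smult_mult_left smult_mult_right smult_simps(3))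
    moreover have "f y = (1/2) * f h + (1/2) * f (y \<otimes> y)"
      using arg_cong[OF y(3), of f] y(1) h by (simp add: add smult del: times_divide_eq_left)
    ultimately have "f (star C w \<otimes> w) = f u - f h"
      using u y h by (simp add: add smult algebra_simps)
    with pos[of w] u y fu show ?thesis
      by (auto simp: w_def complex_is_Real_iff)
  qed
  have herm: "cmod (f h) \<le> 2 * r * cnorm C h" if h: "h \<in> carrier C" "star C h = h" for h
  proof (cases "h = \<zero>")
    case True
    then show ?thesis using smult[of \<zero> 0] by simp
  next
    case False
    \<comment> \<open>Scaling by \<open>c\<close> gives norm 1/2, the largest that
      \<open>below\<close> admits; the scalars \<open>c\<close> and \<open>-c\<close> together give
      a two-sided bound.\<close>
    define c where "c = 1 / (2 * cnorm C h)"
    have c: "c > 0" "c * cnorm C h = 1/2"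
      using False norm_zero_iff[OF h(1)] norm_nonneg[OF h(1)] by (auto simp: c_def)
    have "f (of_real c \<odot> h) \<in> \<real> \<and> Re (f (of_real c \<odot> h)) \<le> r"
      using h c by (intro below) (auto simp: star_smult norm_smult)
    moreover have "f (of_real (-c) \<odot> h) \<in> \<real> \<and> Re (f (of_real (-c) \<odot> h)) \<le> r"
      using h c by (intro below) (auto simp: star_smult norm_smult)
    ultimately have "Im (f h) = 0" "\<bar>c * Re (f h)\<bar> \<le> r"
      using h c by (auto simp: smult complex_is_Real_iff)
    then have "c * cmod (f h) \<le> c * (2 * r * cnorm C h)"
    proof -
      have "c * cmod (f h) = \<bar>c * Re (f h)\<bar>"
        using \<open>Im (f h) = 0\<close> c(1) by (simp add: cmod_eq_Re abs_mult)
      also have "\<dots> \<le> 2 * r * (c * cnorm C h)" using \<open>\<bar>c * Re (f h)\<bar> \<le> r\<close> unfolding c(2) by simp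
      finally show ?thesis by (simp only: ac_simps)
    qed
    then show ?thesis using c(1) by (rule mult_left_le_imp_le)
  qed
  have "cmod (f x) \<le> (4 * r) * cnorm C x" if x: "x \<in> carrier C" for x
  proof -
    \<comment> \<open>The real and imaginary parts of \<open>x\<close>, neither of larger norm than
      \<open>x\<close>; hence the constant \<open>4 * r\<close>.\<close>
    define h k where "h = (1/2) \<odot> x \<oplus> (1/2) \<odot> star C x"
      and "k = (-\<i>/2) \<odot> x \<oplus> (\<i>/2) \<odot> star C x"
    have hk: "h \<in> carrier C" "k \<in> carrier C" "star C h = h" "star C k = k"
      using x by (auto simp: h_def k_def star_add star_smult a_comm)
    have "f x = f h + \<i> * f k"
      using x by (simp add: h_def k_def add smult algebra_simps)
    then have "cmod (f x) \<le> cmod (f h) + cmod (f k)"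
      using norm_triangle_ineq[of "f h" "\<i> * f k"] by (simp add: Real_Vector_Spaces.norm_mult)
    also have "\<dots> \<le> 2 * r * cnorm C h + 2 * r * cnorm C k"
      using hk by (intro add_mono herm)
    also have "\<dots> \<le> 2 * r * cnorm C x + 2 * r * cnorm C x"
      using x fu unfolding h_def k_def
      by (intro add_mono mult_left_mono order.trans[OF norm_triangle]) (auto simp: norm_smult)
    finally show ?thesis by simp
  qed
  with add smult show ?thesis unfolding bounded_functional_def by blast
qed

section \<open>Entire functions with values in the algebra\<close>

text \<open>The functional sends the error term \<open>e\<close> of the difference quotient to 0.
  Thus norm differentiability yields scalar holomorphy, for which the identity theorem is
  available.\<close>

lemma bounded_functional_holomorphic:
  assumes g: "bounded_functional g" and f: "entire_on C f"
  shows "(\<lambda>z. g (f z)) holomorphic_on UNIV"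
proof -
  obtain K where K: "\<And>x. x \<in> carrier C \<Longrightarrow> cmod (g x) \<le> K * cnorm C x"
    using g unfolding bounded_functional_def by blast
  have fC: "f z \<in> carrier C" for z using f by (auto simp: entire_on_def)
  have g_diff: "g (x \<ominus> y) = g x - g y" if "x \<in> carrier C" "y \<in> carrier C" for x y
    using g that by (simp add: bounded_functional_def diff_eq_smult)
  have "\<exists>D. ((\<lambda>z. g (f z)) has_field_derivative D) (at z)" for z
  proof -
    obtain D where D: "D \<in> carrier C"
      "((\<lambda>w. cnorm C (inverse (w - z) \<odot> (f w \<ominus> f z) \<ominus> D)) \<longlongrightarrow> 0) (at z)"
      using f unfolding entire_on_def by blast
    define e where "e = (\<lambda>w. inverse (w - z) \<odot> (f w \<ominus> f z) \<ominus> D)"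
    have eC: "e w \<in> carrier C" for w using D fC by (simp add: e_def)
    have "((\<lambda>w. g (e w)) \<longlongrightarrow> 0) (at z)"
    proof (rule Lim_null_comparison)
      show "eventually (\<lambda>w. cmod (g (e w)) \<le> K * cnorm C (e w)) (at z)"
        using K eC by simp
      show "((\<lambda>w. K * cnorm C (e w)) \<longlongrightarrow> 0) (at z)"
        using D(2) unfolding e_def by (rule tendsto_mult_right_zero)
    qed
    moreover have "g (e w) = (g (f w) - g (f z)) / (w - z) - g D" for w
      using D fC g by (simp add: e_def g_diff bounded_functional_def field_simps)
    ultimately have "((\<lambda>w. (g (f w) - g (f z)) / (w - z)) \<longlongrightarrow> g D) (at z)"
      by (subst LIM_zero_iff[symmetric]) simp
    then show ?thesis unfolding has_field_derivative_iff by blast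
  qed
  then show ?thesis by (simp add: holomorphic_on_def field_differentiable_def)
qed

end

text \<open>The identity theorem, with the real line accumulating at 0.\<close>

lemma entire_eq_zero_if_zero_on_reals:
  assumes "f holomorphic_on UNIV" "\<And>t. f (complex_of_real t) = 0"
  shows "f z = 0"
proof (rule analytic_continuation[of f UNIV "range complex_of_real" 0])
  show "0 islimpt range complex_of_real"
    unfolding islimpt_approachable
  proof (intro allI impI)
    fix e :: real assume "e > 0"
    then show "\<exists>x'\<in>range complex_of_real. x' \<noteq> 0 \<and> dist x' 0 < e"
      by (intro bexI[of _ "complex_of_real (e/2)"] rangeI) auto
  qed
qed (use assms in auto)

section \<open>The Toeplitz algebra, its unit, its core and the expectation\<close>

locale toeplitz_core =
  product_system A G P X mul + NT: cstar_algebra NT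
  for A :: "'a cstar" and G :: "'g monoid" and P and X :: "('g, 'a) fibres"
    and mul :: "('g, 'a) fibre_mult" and NT :: "'c cstar" (structure) +
  fixes n :: "'g \<Rightarrow> nat" and v :: "'g \<Rightarrow> nat \<Rightarrow> 'a" and i :: "'g \<Rightarrow> 'a \<Rightarrow> 'c" and \<Phi> :: "'c \<Rightarrow> 'c"
  assumes finite_type: "finite_type A G P X mul n v"
    and toeplitz: "toeplitz_rep A G P X mul NT i"
    and spanned: "closed_span NT {i s \<xi> \<otimes> star NT (i r \<eta>) | s r \<xi> \<eta>.
       s \<in> P \<and> r \<in> P \<and> \<xi> \<in> carrier (X s) \<and> \<eta> \<in> carrier (X r)} = carrier NT"
    and expectation: "core_expectation P X NT i \<Phi>"
begin

abbreviation "F \<equiv> core P X NT i"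

lemma core_simps [simp]:
  "mult F = mult NT" "add F = add NT" "zero F = zero NT" "smult F = smult NT"
  "star F = star NT" "cnorm F = cnorm NT"
  by (simp_all add: core_def)

lemma group_G: "comm_group G" and submonoid_P: "submonoid P G"
  using lattice_ordered by (auto simp: lattice_ordered_group_def)

lemma P_closed: "s \<in> P \<Longrightarrow> s \<in> carrier G"
  using submonoid_P submonoid.subset by blast

lemma one_P: "\<one>\<^bsub>G\<^esub> \<in> P" and mult_P: "s \<in> P \<Longrightarrow> r \<in> P \<Longrightarrow> s \<otimes>\<^bsub>G\<^esub> r \<in> P"
  using submonoid_P by (auto simp: submonoid_def)

lemma one_mult_P: "s \<in> P \<Longrightarrow> \<one>\<^bsub>G\<^esub> \<otimes>\<^bsub>G\<^esub> s = s"
  using group_G P_closed by (simp add: comm_group_def group_def monoid.l_one)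

lemma unit_fibre: "carrier (X \<one>\<^bsub>G\<^esub>) = carrier A"
  by (simp add: fibre_unit self_bimod_def)

lemma i_closed [simp]: "s \<in> P \<Longrightarrow> \<xi> \<in> carrier (X s) \<Longrightarrow> i s \<xi> \<in> carrier NT"
  using toeplitz by (auto simp: toeplitz_rep_def linear_on_def)

lemma i_unit_closed [simp]: "a \<in> carrier A \<Longrightarrow> i \<one>\<^bsub>G\<^esub> a \<in> carrier NT"
  by (rule i_closed) (simp_all add: one_P unit_fibre)

lemma i_mult:
  "\<lbrakk>s \<in> P; r \<in> P; \<xi> \<in> carrier (X s); \<eta> \<in> carrier (X r)\<rbrakk>
    \<Longrightarrow> i s \<xi> \<otimes> i r \<eta> = i (s \<otimes>\<^bsub>G\<^esub> r) (mul s r \<xi> \<eta>)"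
  using toeplitz by (simp add: toeplitz_rep_def)

lemma i_unit_hom: "star_hom A NT (i \<one>\<^bsub>G\<^esub>)"
  using toeplitz by (simp add: toeplitz_rep_def)

lemma v_closed [simp]: "s \<in> P \<Longrightarrow> j < n s \<Longrightarrow> v s j \<in> carrier (X s)"
  using finite_type unfolding finite_type_def by blast

lemma lact_closed: "\<lbrakk>s \<in> P; a \<in> carrier A; \<xi> \<in> carrier (X s)\<rbrakk> \<Longrightarrow> lact (X s) a \<xi> \<in> carrier (X s)"
  using mul_closed[of "\<one>\<^bsub>G\<^esub>" s a \<xi>] by (simp add: mul_unit_left one_P unit_fibre one_mult_P)

lemma i_lact: "\<lbrakk>s \<in> P; a \<in> carrier A; \<xi> \<in> carrier (X s)\<rbrakk> \<Longrightarrow> i s (lact (X s) a \<xi>) = i \<one>\<^bsub>G\<^esub> a \<otimes> i s \<xi>"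
  by (simp add: i_mult mul_unit_left one_P unit_fibre one_mult_P)

text \<open>By finite type every vector is a finite sum of left multiples of the
  \<open>v s j\<close>, and \<open>i\<close> turns a left multiple into a product. Scalars are
  absorbed into the coefficient \<open>a\<close>.\<close>

lemma i_fibre_induct [consumes 2, case_names zero add gen]:
  assumes s: "s \<in> P" and \<xi>: "\<xi> \<in> carrier (X s)"
    and zero: "Q \<zero>"
    and add: "\<And>x y. \<lbrakk>x \<in> carrier NT; y \<in> carrier NT; Q x; Q y\<rbrakk> \<Longrightarrow> Q (x \<oplus> y)"
    and gen: "\<And>a j. \<lbrakk>a \<in> carrier A; j < n s\<rbrakk> \<Longrightarrow> Q (i \<one>\<^bsub>G\<^esub> a \<otimes> i s (v s j))"
  shows "Q (i s \<xi>)"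
proof -
  have Xs: "complex_space (X s)"
    using fibre[OF s] by (simp add: hilbert_bimodule_def hilbert_module_def)
  interpret V: abelian_group "X s" using Xs by (rule module.axioms)
  have lin: "i s (x \<oplus>\<^bsub>X s\<^esub> y) = i s x \<oplus> i s y" "i s (c \<odot>\<^bsub>X s\<^esub> x) = c \<odot> i s x"
    if "x \<in> carrier (X s)" "y \<in> carrier (X s)" for x y c
    using toeplitz s that by (auto simp: toeplitz_rep_def linear_on_def)
  from \<xi> s finite_type obtain a where a: "a \<in> {..<n s} \<rightarrow> carrier A"
    and "\<xi> = finsum (X s) (\<lambda>j. lact (X s) (a j) (v s j)) {..<n s}"
    unfolding finite_type_def by blast
  \<comment> \<open>The induction adds one summand at a time; the bound on \<open>m\<close> is there
    because \<open>a\<close> is known to take values in \<open>A\<close> only below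
    \<open>n s\<close>.\<close>
  moreover have "Q (i s (finsum (X s) (\<lambda>j. lact (X s) (a j) (v s j)) {..<m}))" if "m \<le> n s" for m
    using that
  proof (induction m)
    case 0
    have "i s \<zero>\<^bsub>X s\<^esub> = \<zero>"
      using lin(2)[of "\<zero>\<^bsub>X s\<^esub>" "\<zero>\<^bsub>X s\<^esub>" 0] complex_space_smult(6)[OF Xs, of "\<zero>\<^bsub>X s\<^esub>"] s
      by simp
    then show ?case using zero by simp
  next
    case (Suc m)
    have cl: "(\<lambda>j. lact (X s) (a j) (v s j)) \<in> {..<Suc m} \<rightarrow> carrier (X s)"
      using Suc.prems a s by (auto intro!: lact_closed)
    then have *: "finsum (X s) (\<lambda>j. lact (X s) (a j) (v s j)) {..<m} \<in> carrier (X s)"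
      "lact (X s) (a m) (v s m) \<in> carrier (X s)"
      by (auto intro!: V.finsum_closed)
    have "i s (finsum (X s) (\<lambda>j. lact (X s) (a j) (v s j)) {..<Suc m})
        = i s (lact (X s) (a m) (v s m)) \<oplus> i s (finsum (X s) (\<lambda>j. lact (X s) (a j) (v s j)) {..<m})"
      using cl * by (simp add: lessThan_Suc lin Pi_iff)
    also have "Q \<dots>"
    proof (intro add)
      have "a m \<in> carrier A" "m < n s" using a Suc.prems by auto
      then show "Q (i s (lact (X s) (a m) (v s m)))" using s gen by (simp add: i_lact)
    qed (use Suc * s in simp_all)
    finally show ?case .
  qed
  ultimately show ?thesis by simp
qed

text \<open>The field \<open>one\<close> of \<open>NT\<close> carries no information, so a unit has
  to be produced: the image of the unit of \<open>A\<close> turns out to be one.\<close>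

definition unit :: 'c where "unit = i \<one>\<^bsub>G\<^esub> \<one>\<^bsub>A\<^esub>"

lemma unit_closed [simp]: "unit \<in> carrier NT"
  using coefficients by (simp add: unit_def unital_cstar_algebra.one_closed)

lemma star_unit [simp]: "star NT unit = unit"
proof -
  interpret A: unital_cstar_algebra A by (rule coefficients)
  have "star A \<one>\<^bsub>A\<^esub> = \<one>\<^bsub>A\<^esub>"
    using A.star_mult[of "star A \<one>\<^bsub>A\<^esub>" "\<one>\<^bsub>A\<^esub>"] by (simp add: A.one_closed A.one_left A.one_right)
  then show ?thesis
    using i_unit_hom A.one_closed unfolding star_hom_def unit_def by metis
qed

lemma unit_i:
  assumes "s \<in> P" "\<xi> \<in> carrier (X s)"
  shows "unit \<otimes> i s \<xi> = i s \<xi>"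
  using assms
proof (induction rule: i_fibre_induct)
  case zero
  show ?case using NT.smult_mult_right[of unit \<zero> 0] by simp
next
  case (add x y)
  then show ?case by (simp add: NT.distr_right)
next
  case (gen a j)
  interpret A: unital_cstar_algebra A by (rule coefficients)
  have "unit \<otimes> i \<one>\<^bsub>G\<^esub> a = i \<one>\<^bsub>G\<^esub> a"
    using i_unit_hom gen(1) A.one_closed A.one_left by (simp add: star_hom_def unit_def) metis
  then show ?case using gen assms(1) by (simp flip: NT.mult_assoc)
qed

lemma generators_closed:
  "{i s \<xi> \<otimes> star NT (i r \<eta>) | s r \<xi> \<eta>. s \<in> P \<and> r \<in> P \<and> \<xi> \<in> carrier (X s) \<and> \<eta> \<in> carrier (X r)}
    \<subseteq> carrier NT"
  by auto

text \<open>Multiplication by \<open>unit\<close> is bounded and fixes the generators by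
  \<open>unit_i\<close>; their span is dense.\<close>

lemma unit_left [simp]:
  assumes x: "x \<in> carrier NT"
  shows "unit \<otimes> x = x"
proof -
  have "cnorm NT (unit \<otimes> x \<ominus> x) = 0"
  proof (rule NT.closed_span_seminorm_zero[OF generators_closed, where K = "cnorm NT unit + 1" and
        p = "\<lambda>x. cnorm NT (unit \<otimes> x \<ominus> x)"])
    fix x y assume xy: "x \<in> carrier NT" "y \<in> carrier NT"
    then have "unit \<otimes> (x \<oplus> y) \<ominus> (x \<oplus> y) = (unit \<otimes> x \<ominus> x) \<oplus> (unit \<otimes> y \<ominus> y)"
      by (simp add: NT.distr_right NT.minus_eq NT.minus_add NT.a_ac)
    then show "cnorm NT (unit \<otimes> (x \<oplus> y) \<ominus> (x \<oplus> y)) \<le> cnorm NT (unit \<otimes> x \<ominus> x) + cnorm NT (unit \<otimes> y \<ominus> y)"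
      using xy by (simp add: NT.norm_triangle)
  next
    fix c x assume "x \<in> carrier NT"
    then show "cnorm NT (unit \<otimes> (c \<odot> x) \<ominus> c \<odot> x) = cmod c * cnorm NT (unit \<otimes> x \<ominus> x)"
      by (simp add: NT.smult_mult_right NT.norm_smult flip: NT.smult_diff)
  next
    fix x assume x: "x \<in> carrier NT"
    have "cnorm NT (unit \<otimes> x \<ominus> x) \<le> cnorm NT (unit \<otimes> x) + cnorm NT x"
      using NT.norm_triangle[of "unit \<otimes> x" "(-1) \<odot> x"] x by (simp add: NT.diff_eq_smult NT.norm_smult)
    also have "\<dots> \<le> (cnorm NT unit + 1) * cnorm NT x"
      using NT.norm_mult[of unit x] x by (simp add: algebra_simps)
    finally show "cnorm NT (unit \<otimes> x \<ominus> x) \<le> (cnorm NT unit + 1) * cnorm NT x" .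
  qed (use x spanned in \<open>auto simp: unit_i simp flip: NT.mult_assoc\<close>)
  then show ?thesis using x by (simp add: NT.norm_zero_iff NT.diff_eq_zero_iff)
qed

lemma unit_right [simp]:
  assumes "x \<in> carrier NT"
  shows "x \<otimes> unit = x"
  using NT.star_mult[of unit "star NT x"] assms by simp

text \<open>The Toeplitz relation turns the inner product of \<open>v s j\<close> with itself, which
  is the unit of \<open>A\<close>, into this product.\<close>

lemma isometry: "s \<in> P \<Longrightarrow> j < n s \<Longrightarrow> star NT (i s (v s j)) \<otimes> i s (v s j) = unit"
  using toeplitz finite_type v_closed[of s j] unfolding toeplitz_rep_def finite_type_def unit_def
  by metis

lemma core_closed: "y \<in> carrier F \<Longrightarrow> y \<in> carrier NT"
  by (simp add: core_def closed_span_def norm_closure_def)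

lemma core_generator:
  "\<lbrakk>s \<in> P; \<xi> \<in> carrier (X s); \<eta> \<in> carrier (X s)\<rbrakk> \<Longrightarrow> i s \<xi> \<otimes> star NT (i s \<eta>) \<in> carrier F"
  unfolding core_def by (auto intro!: NT.closed_span_superset[THEN subsetD])

text \<open>Multiplying by the adjoint of \<open>unit\<close> exhibits the element as a core
  generator in degree \<open>e\<close>.\<close>

lemma i_unit_core: "a \<in> carrier A \<Longrightarrow> i \<one>\<^bsub>G\<^esub> a \<in> carrier F"
  using core_generator[of "\<one>\<^bsub>G\<^esub>" a "\<one>\<^bsub>A\<^esub>"] unital_cstar_algebra.one_closed[OF coefficients]
  by (simp add: one_P unit_fibre flip: unit_def)

lemma \<Phi>_closed: "x \<in> carrier NT \<Longrightarrow> \<Phi> x \<in> carrier F"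
  using expectation by (auto simp: core_expectation_def conditional_expectation_def linear_on_def)

lemma \<Phi>_core: "y \<in> carrier F \<Longrightarrow> \<Phi> y = y"
  using expectation by (auto simp: core_expectation_def conditional_expectation_def)

lemma \<Phi>_bimodule:
  assumes "x \<in> carrier NT" "y \<in> carrier F"
  shows "\<Phi> (y \<otimes> x) = y \<otimes> \<Phi> x" "\<Phi> (x \<otimes> y) = \<Phi> x \<otimes> y"
  using expectation assms by (auto simp: core_expectation_def conditional_expectation_def)

lemma \<Phi>_generator:
  "\<lbrakk>s \<in> P; r \<in> P; s \<noteq> r; \<xi> \<in> carrier (X s); \<eta> \<in> carrier (X r)\<rbrakk> \<Longrightarrow> \<Phi> (i s \<xi> \<otimes> star NT (i r \<eta>)) = \<zero>"
  using expectation by (auto simp: core_expectation_def)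

lemma \<Phi>_zero [simp]: "\<Phi> \<zero> = \<zero>"
proof -
  have "\<Phi> (0 \<odot> \<zero>) = 0 \<odot> \<Phi> \<zero>"
    using expectation NT.zero_closed
    unfolding core_expectation_def conditional_expectation_def linear_on_def core_simps by blast
  then show ?thesis using core_closed[OF \<Phi>_closed[OF NT.zero_closed]] by simp
qed

text \<open>Positivity and contractivity come from \<open>\<Phi>\<close>. The norm does not drop
  below one because \<open>\<Phi>\<close> is the identity on the core, so a bound for the composite
  also bounds \<open>\<phi>\<close>.\<close>

lemma state_comp_\<Phi>:
  assumes \<phi>: "state F \<phi>"
  shows "state NT (\<phi> \<circ> \<Phi>)"
proof -
  have ce: "linear_on NT F \<Phi>" "\<And>c. c \<in> carrier NT \<Longrightarrow> cnorm NT (\<Phi> c) \<le> cnorm NT c"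
    "\<And>c. c \<in> carrier NT \<Longrightarrow> positive NT c \<Longrightarrow> positive F (\<Phi> c)"
    using expectation by (auto simp: core_expectation_def conditional_expectation_def)
  show ?thesis
    unfolding state_def
  proof (intro conjI allI ballI impI)
    fix K assume K: "\<forall>x\<in>carrier NT. cmod ((\<phi> \<circ> \<Phi>) x) \<le> K * cnorm NT x"
    have "cmod (\<phi> x) \<le> K * cnorm F x" if "x \<in> carrier F" for x
      using K that core_closed[OF that] \<Phi>_core[OF that] by (metis comp_apply core_simps(6))
    then show "1 \<le> K" using \<phi> unfolding state_def by blast
  next
    fix x assume x: "x \<in> carrier NT"
    show "cmod ((\<phi> \<circ> \<Phi>) x) \<le> cnorm NT x"
      using \<phi> \<Phi>_closed[OF x] ce(2)[OF x] unfolding state_def by (force simp: o_def)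
  next
    fix x assume x: "x \<in> carrier NT" "positive NT x"
    then have "positive F (\<Phi> x)" by (rule ce)
    then show "(\<phi> \<circ> \<Phi>) x \<in> \<real>" "0 \<le> Re ((\<phi> \<circ> \<Phi>) x)"
      using \<phi> \<Phi>_closed[OF x(1)] by (simp_all add: state_def)
  qed (use \<phi> ce(1) \<Phi>_closed in \<open>simp_all add: state_def linear_on_def\<close>)
qed

end

section \<open>The scaling trace and the twisted trace relation\<close>

locale scaling_trace = toeplitz_core +
  fixes \<phi> :: "'c \<Rightarrow> complex" and N :: "'b \<Rightarrow> real" and \<beta> :: real
  assumes trace: "tracial_state F \<phi>"
    and N_hom: "positive_reals_hom G N"
    and scaling: "\<lbrakk>y \<in> carrier F; s \<in> P; j < n s\<rbrakk> \<Longrightarrow>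
      \<phi> (i s (v s j) \<otimes> y \<otimes> star NT (i s (v s j))) = complex_of_real (N s powr - \<beta>) * \<phi> y"
begin

abbreviation "\<omega> \<equiv> \<phi> \<circ> \<Phi>"

lemma state_\<omega>: "state NT \<omega>"
  using trace by (intro state_comp_\<Phi>) (simp add: tracial_state_def)

lemma \<omega>_bounded: "NT.bounded_functional \<omega>"
  using state_\<omega> unfolding NT.bounded_functional_def state_def
  by (metis mult_1)

lemma \<phi>_zero [simp]: "\<phi> \<zero> = 0"
proof -
  have "\<omega> (0 \<odot> \<zero>) = 0 * \<omega> \<zero>"
    using \<omega>_bounded NT.zero_closed unfolding NT.bounded_functional_def by blast
  then show ?thesis by simp
qed

lemma N_pos: "s \<in> P \<Longrightarrow> N s > 0"
  using N_hom P_closed by (auto simp: positive_reals_hom_def)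

lemma \<omega>_core_commute:
  assumes "y \<in> carrier F" "d \<in> carrier NT"
  shows "\<omega> (y \<otimes> d) = \<omega> (d \<otimes> y)"
  using trace assms \<Phi>_closed by (simp add: \<Phi>_bimodule tracial_state_def)

text \<open>Both sides are continuous in \<open>x\<close>, so generators suffice. In equal degrees
  this is \<open>scaling\<close>. In degrees \<open>p \<noteq> q\<close> cancellation in
  \<open>G\<close> keeps the compressed element off the diagonal, and \<open>\<Phi>\<close>
  annihilates both sides.\<close>

lemma \<omega>_compress:
  assumes s: "s \<in> P" "j < n s" and x: "x \<in> carrier NT"
  shows "\<omega> (i s (v s j) \<otimes> x \<otimes> star NT (i s (v s j))) = complex_of_real (N s powr - \<beta>) * \<omega> x"
proof (rule NT.bounded_functional_eq_on_closed_span[OF _ _ generators_closed])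
  define S where "S = i s (v s j)"
  have S: "S \<in> carrier NT" using s by (simp add: S_def)
  show "NT.bounded_functional (\<lambda>x. \<omega> (S \<otimes> x \<otimes> star NT S))"
    using NT.bounded_functional_mult(1)[OF NT.bounded_functional_mult(2)[OF \<omega>_bounded, of "star NT S"] S]
      S by simp
  show "NT.bounded_functional (\<lambda>x. complex_of_real (N s powr - \<beta>) * \<omega> x)"
    by (rule NT.bounded_functional_scale) (rule \<omega>_bounded)
  show "x \<in> closed_span NT {i s \<xi> \<otimes> star NT (i r \<eta>) | s r \<xi> \<eta>.
       s \<in> P \<and> r \<in> P \<and> \<xi> \<in> carrier (X s) \<and> \<eta> \<in> carrier (X r)}"
    using x spanned by simp
  fix x assume "x \<in> {i s \<xi> \<otimes> star NT (i r \<eta>) | s r \<xi> \<eta>.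
       s \<in> P \<and> r \<in> P \<and> \<xi> \<in> carrier (X s) \<and> \<eta> \<in> carrier (X r)}"
  then obtain p q \<xi> \<eta> where pq: "p \<in> P" "q \<in> P" and \<xi>\<eta>: "\<xi> \<in> carrier (X p)" "\<eta> \<in> carrier (X q)"
    and x: "x = i p \<xi> \<otimes> star NT (i q \<eta>)" by blast
  have sP: "s \<otimes>\<^bsub>G\<^esub> p \<in> P" "s \<otimes>\<^bsub>G\<^esub> q \<in> P" using s pq by (simp_all add: mult_P)
  have mC: "mul s p (v s j) \<xi> \<in> carrier (X (s \<otimes>\<^bsub>G\<^esub> p))" "mul s q (v s j) \<eta> \<in> carrier (X (s \<otimes>\<^bsub>G\<^esub> q))"
    using s pq \<xi>\<eta> by (simp_all add: mul_closed)
  \<comment> \<open>Compression by \<open>S\<close> shifts both degrees of a generator by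
    \<open>s\<close>.\<close>
  have "S \<otimes> x \<otimes> star NT S = (S \<otimes> i p \<xi>) \<otimes> star NT (S \<otimes> i q \<eta>)"
    using S pq \<xi>\<eta> by (simp add: x NT.star_mult NT.mult_assoc)
  then have Sx: "S \<otimes> x \<otimes> star NT S
      = i (s \<otimes>\<^bsub>G\<^esub> p) (mul s p (v s j) \<xi>) \<otimes> star NT (i (s \<otimes>\<^bsub>G\<^esub> q) (mul s q (v s j) \<eta>))"
    using s pq \<xi>\<eta> by (simp add: S_def i_mult)
  show "\<omega> (S \<otimes> x \<otimes> star NT S) = complex_of_real (N s powr - \<beta>) * \<omega> x"
  proof (cases "p = q")
    case True
    have "x \<in> carrier F" "S \<otimes> x \<otimes> star NT S \<in> carrier F"
      unfolding Sx unfolding x using True pq \<xi>\<eta> sP mC by (auto intro!: core_generator)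
    then show ?thesis using scaling[of x s j] s by (simp add: \<Phi>_core S_def)
  next
    case False
    have "s \<otimes>\<^bsub>G\<^esub> p \<noteq> s \<otimes>\<^bsub>G\<^esub> q"
    proof -
      interpret G: comm_group G by (rule group_G)
      show ?thesis using False s pq P_closed by (simp add: G.Units_l_cancel G.Units_eq)
    qed
    then show ?thesis unfolding Sx unfolding x using False pq \<xi>\<eta> sP mC by (simp add: \<Phi>_generator)
  qed
qed

text \<open>The KMS relation in algebraic form, for an element whose analytic continuation to
  \<open>\<i>\<beta>\<close> is a real multiple of itself. Letting \<open>d\<close> be arbitrary
  makes the relation multiplicative in \<open>x\<close>.\<close>

definition scales :: "real \<Rightarrow> 'c \<Rightarrow> bool" where
  "scales \<kappa> x \<longleftrightarrow>
     x \<in> carrier NT \<and> (\<forall>d\<in>carrier NT. \<omega> (x \<otimes> d) = complex_of_real \<kappa> * \<omega> (d \<otimes> x))"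

lemma scales_zero: "scales \<kappa> \<zero>"
  using NT.smult_mult_left[of \<zero> _ 0] NT.smult_mult_right[of _ \<zero> 0] by (simp add: scales_def)

lemma scales_add:
  assumes "scales \<kappa> x" "scales \<kappa> y"
  shows "scales \<kappa> (x \<oplus> y)"
proof -
  have "\<omega> (a \<oplus> b) = \<omega> a + \<omega> b" if "a \<in> carrier NT" "b \<in> carrier NT" for a b
    using \<omega>_bounded that by (simp add: NT.bounded_functional_def)
  with assms show ?thesis
    by (auto simp: scales_def NT.distr_left NT.distr_right algebra_simps simp del: comp_apply)
qed

text \<open>The factors move around cyclically one at a time, from \<open>xyd\<close> to
  \<open>ydx\<close> to \<open>dxy\<close>, and their constants multiply.\<close>

lemma scales_mult:
  assumes x: "scales \<kappa> x" and y: "scales \<mu> y"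
  shows "scales (\<kappa> * \<mu>) (x \<otimes> y)"
  unfolding scales_def
proof (intro conjI ballI)
  have C: "x \<in> carrier NT" "y \<in> carrier NT" using x y by (simp_all add: scales_def)
  then show "x \<otimes> y \<in> carrier NT" by simp
  fix d assume d: "d \<in> carrier NT"
  have "\<omega> (x \<otimes> (y \<otimes> d)) = complex_of_real \<kappa> * \<omega> (y \<otimes> (d \<otimes> x))"
    using x C d unfolding scales_def by (metis NT.mult_assoc NT.mult_closed)
  also have "\<dots> = complex_of_real \<kappa> * (complex_of_real \<mu> * \<omega> (d \<otimes> x \<otimes> y))"
    using y C d unfolding scales_def by (metis NT.mult_closed)
  finally show "\<omega> (x \<otimes> y \<otimes> d) = complex_of_real (\<kappa> * \<mu>) * \<omega> (d \<otimes> (x \<otimes> y))"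
    using C d by (simp add: NT.mult_assoc)
qed

lemma scales_core: "y \<in> carrier F \<Longrightarrow> scales 1 y"
  using \<omega>_core_commute core_closed by (simp add: scales_def)

lemma scales_isometry:
  assumes s: "s \<in> P" "j < n s"
  shows "scales (N s powr - \<beta>) (i s (v s j))" "scales (1 / N s powr - \<beta>) (star NT (i s (v s j)))"
proof -
  define S where "S = i s (v s j)"
  have S: "S \<in> carrier NT" "star NT S \<otimes> S = unit" "S \<otimes> star NT S \<in> carrier F"
    using s core_generator isometry by (auto simp: S_def)
  note compress = \<omega>_compress[OF s, folded S_def]
  have SSS: "S \<otimes> star NT S \<otimes> S = S" "star NT S \<otimes> (S \<otimes> star NT S) = star NT S"
    using S NT.mult_assoc[of S "star NT S" S] NT.mult_assoc[of "star NT S" S "star NT S"] by simp_all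
  have "\<omega> (S \<otimes> d) = complex_of_real (N s powr - \<beta>) * \<omega> (d \<otimes> S)" if d: "d \<in> carrier NT" for d
  proof -
    have "\<omega> (S \<otimes> d) = \<omega> ((S \<otimes> star NT S) \<otimes> (S \<otimes> d))"
      using S d by (simp add: SSS flip: NT.mult_assoc)
    also have "\<dots> = \<omega> ((S \<otimes> d) \<otimes> (S \<otimes> star NT S))"
      using S d by (intro \<omega>_core_commute) auto
    also have "\<dots> = \<omega> (S \<otimes> (d \<otimes> S) \<otimes> star NT S)"
      using S d by (simp add: NT.mult_assoc)
    finally show ?thesis using compress[of "d \<otimes> S"] S d by simp
  qed
  then show "scales (N s powr - \<beta>) (i s (v s j))" using S by (simp add: scales_def flip: S_def)
  \<comment> \<open>Here the range projection is inserted on the right of \<open>star NT S\<close>.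
    The compression then produces its factor on the opposite side, which explains the
    reciprocal.\<close>
  have "\<omega> (star NT S \<otimes> d) = complex_of_real (1 / N s powr - \<beta>) * \<omega> (d \<otimes> star NT S)"
    if d: "d \<in> carrier NT" for d
  proof -
    have "\<omega> (d \<otimes> star NT S) = \<omega> ((d \<otimes> star NT S) \<otimes> (S \<otimes> star NT S))"
      using S d by (simp add: SSS NT.mult_assoc)
    also have "\<dots> = \<omega> ((S \<otimes> star NT S) \<otimes> (d \<otimes> star NT S))"
      using S d by (intro \<omega>_core_commute[symmetric]) auto
    also have "\<dots> = \<omega> (S \<otimes> (star NT S \<otimes> d) \<otimes> star NT S)"
      using S d by (simp add: NT.mult_assoc)
    finally show ?thesis using compress[of "star NT S \<otimes> d"] S d N_pos[OF s(1)] by simp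
  qed
  then show "scales (1 / N s powr - \<beta>) (star NT (i s (v s j)))"
    using S by (simp add: scales_def flip: S_def)
qed

text \<open>On a generator, the coefficient lies in the core and has factor 1, while the isometry
  carries the power of \<open>N s\<close>. Adjoints are treated together, since \<open>A\<close> is
  closed under the involution.\<close>

lemma scales_i:
  assumes "s \<in> P" "\<xi> \<in> carrier (X s)"
  shows "scales (N s powr - \<beta>) (i s \<xi>) \<and> scales (1 / N s powr - \<beta>) (star NT (i s \<xi>))"
  using assms
proof (induction rule: i_fibre_induct)
  case zero
  have "star NT \<zero> = \<zero>" using NT.star_smult[of \<zero> 0] by simp
  then show ?case by (simp add: scales_zero)
next
  case (add x y)
  then show ?case by (simp add: NT.star_add scales_add)
next
  case (gen a j)
  interpret A: unital_cstar_algebra A by (rule coefficients)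
  have "star NT (i \<one>\<^bsub>G\<^esub> a) = i \<one>\<^bsub>G\<^esub> (star A a)"
    using i_unit_hom gen by (simp add: star_hom_def)
  then have "scales 1 (i \<one>\<^bsub>G\<^esub> a)" "scales 1 (star NT (i \<one>\<^bsub>G\<^esub> a))"
    using gen by (auto intro!: scales_core i_unit_core)
  with scales_isometry[OF assms(1) gen(2)] scales_mult show ?case
    using gen assms(1) by (fastforce simp: NT.star_mult)
qed

lemma scales_generator:
  assumes "p \<in> P" "q \<in> P" "\<zeta> \<in> carrier (X p)" "\<mu> \<in> carrier (X q)"
  shows "scales (N p powr - \<beta> / N q powr - \<beta>) (i p \<zeta> \<otimes> star NT (i q \<mu>))"
  using scales_mult[OF scales_i[OF assms(1,3), THEN conjunct1] scales_i[OF assms(2,4), THEN conjunct2]]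
  by simp

section \<open>The dynamics and the KMS condition\<close>

context
  fixes \<sigma> :: "real \<Rightarrow> 'c \<Rightarrow> 'c"
  assumes dynamics: "dynamics_from A G P X NT i N \<sigma>"
begin

lemma \<sigma>_hom: "star_hom NT NT (\<sigma> t)"
  using dynamics by (auto simp: dynamics_from_def cstar_dynamics_def)

lemma \<sigma>_closed [simp]: "x \<in> carrier NT \<Longrightarrow> \<sigma> t x \<in> carrier NT"
  using \<sigma>_hom[of t] by (auto simp: star_hom_def linear_on_def)

text \<open>The powers of \<open>N\<close> are written as exponentials so that they extend to entire
  functions of \<open>t\<close>. The adjoint conjugates its factor, which gives the minus sign at
  \<open>ln (N q)\<close>.\<close>

lemma \<sigma>_generator:
  assumes pq: "p \<in> P" "q \<in> P" and C: "\<zeta> \<in> carrier (X p)" "\<mu> \<in> carrier (X q)"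
  shows "\<sigma> t (i p \<zeta> \<otimes> star NT (i q \<mu>))
      = exp (\<i> * complex_of_real t * complex_of_real (ln (N p) - ln (N q))) \<odot> (i p \<zeta> \<otimes> star NT (i q \<mu>))"
proof -
  have i: "\<sigma> t (i s \<xi>) = exp (\<i> * complex_of_real t * complex_of_real (ln (N s))) \<odot> i s \<xi>"
    if "s \<in> P" "\<xi> \<in> carrier (X s)" for s \<xi>
    using dynamics N_pos[OF that(1)] that
    by (simp add: dynamics_from_def powr_def Ln_of_real)
  have "\<sigma> t (i p \<zeta> \<otimes> star NT (i q \<mu>)) = \<sigma> t (i p \<zeta>) \<otimes> star NT (\<sigma> t (i q \<mu>))"
    using \<sigma>_hom[of t] pq C by (simp add: star_hom_def)
  also have "\<dots> = (cnj (exp (\<i> * complex_of_real t * complex_of_real (ln (N q))))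
      * exp (\<i> * complex_of_real t * complex_of_real (ln (N p)))) \<odot> (i p \<zeta> \<otimes> star NT (i q \<mu>))"
    using pq C by (simp add: i NT.star_smult NT.smult_mult_left NT.smult_mult_right NT.smult_simps(4))
  also have "cnj (exp (\<i> * complex_of_real t * complex_of_real (ln (N q))))
      * exp (\<i> * complex_of_real t * complex_of_real (ln (N p)))
      = exp (\<i> * complex_of_real t * complex_of_real (ln (N p) - ln (N q)))"
    by (simp add: exp_cnj algebra_simps flip: exp_add)
  finally show ?thesis .
qed

text \<open>Continuity of \<open>\<sigma> t\<close> is not at hand, but \<open>\<omega> \<circ> \<sigma> t\<close> is positive and therefore bounded, so that
  it is determined by its values on the generators.\<close>

lemma \<omega>_invariant:
  assumes x: "x \<in> carrier NT"
  shows "\<omega> (\<sigma> t x) = \<omega> x"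
proof (rule NT.bounded_functional_eq_on_closed_span[OF _ \<omega>_bounded generators_closed])
  show "NT.bounded_functional (\<lambda>x. \<omega> (\<sigma> t x))"
  proof (rule NT.positive_functional_bounded[of unit])
    fix x assume x: "x \<in> carrier NT"
    have "\<sigma> t (star NT x \<otimes> x) = star NT (\<sigma> t x) \<otimes> \<sigma> t x"
      using \<sigma>_hom[of t] x by (simp add: star_hom_def)
    then have "positive NT (\<sigma> t (star NT x \<otimes> x))"
      using x unfolding positive_def by (metis \<sigma>_closed)
    then show "\<omega> (\<sigma> t (star NT x \<otimes> x)) \<in> \<real> \<and> 0 \<le> Re (\<omega> (\<sigma> t (star NT x \<otimes> x)))"
      using state_\<omega> x unfolding state_def by (metis NT.mult_closed NT.star_closed \<sigma>_closed)
  next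
    fix c x assume "x \<in> carrier NT"
    then show "\<omega> (\<sigma> t (c \<odot> x)) = c * \<omega> (\<sigma> t x)"
      using \<sigma>_hom[of t] \<omega>_bounded
      by (simp add: star_hom_def linear_on_def NT.bounded_functional_def)
  next
    fix x y assume "x \<in> carrier NT" "y \<in> carrier NT"
    then show "\<omega> (\<sigma> t (x \<oplus> y)) = \<omega> (\<sigma> t x) + \<omega> (\<sigma> t y)"
      using \<sigma>_hom[of t] \<omega>_bounded
      by (simp add: star_hom_def linear_on_def NT.bounded_functional_def)
  qed simp_all
  show "x \<in> closed_span NT {i s \<xi> \<otimes> star NT (i r \<eta>) | s r \<xi> \<eta>.
       s \<in> P \<and> r \<in> P \<and> \<xi> \<in> carrier (X s) \<and> \<eta> \<in> carrier (X r)}"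
    using x spanned by simp
  fix x assume "x \<in> {i s \<xi> \<otimes> star NT (i r \<eta>) | s r \<xi> \<eta>.
       s \<in> P \<and> r \<in> P \<and> \<xi> \<in> carrier (X s) \<and> \<eta> \<in> carrier (X r)}"
  then obtain p q \<xi> \<eta> where pq: "p \<in> P" "q \<in> P" "\<xi> \<in> carrier (X p)" "\<eta> \<in> carrier (X q)"
    and x: "x = i p \<xi> \<otimes> star NT (i q \<eta>)" by blast
  have xC: "x \<in> carrier NT" using pq x by simp
  have "\<omega> (\<sigma> t x) = exp (\<i> * complex_of_real t * complex_of_real (ln (N p) - ln (N q))) * \<omega> x"
    using \<sigma>_generator[OF pq, of t] \<omega>_bounded xC unfolding x NT.bounded_functional_def by metis
  \<comment> \<open>For \<open>p = q\<close> the exponent is zero; otherwise \<open>\<omega>\<close>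
    vanishes on \<open>x\<close>.\<close>
  then show "\<omega> (\<sigma> t x) = \<omega> x"
    using pq by (cases "p = q") (simp_all add: x \<Phi>_generator)
qed

lemma kms_condition:
  assumes c: "c \<in> carrier NT" and f: "entire_extension NT \<sigma> c f" and d: "d \<in> carrier NT"
  shows "\<omega> (c \<otimes> d) = \<omega> (d \<otimes> f (\<i> * complex_of_real \<beta>))"
proof (rule NT.bounded_functional_eq_on_closed_span[OF _ _ generators_closed,
      where f = "\<lambda>d. \<omega> (c \<otimes> d)" and g = "\<lambda>d. \<omega> (d \<otimes> f (\<i> * complex_of_real \<beta>))"])
  have ent: "entire_on NT f" and f_real: "f (complex_of_real t) = \<sigma> t c" for t
    using f by (simp_all add: entire_extension_def)
  have fC: "f z \<in> carrier NT" for z using ent by (auto simp: entire_on_def)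
  show "NT.bounded_functional (\<lambda>d. \<omega> (c \<otimes> d))"
    using NT.bounded_functional_mult(1)[OF \<omega>_bounded c] .
  show "NT.bounded_functional (\<lambda>d. \<omega> (d \<otimes> f (\<i> * complex_of_real \<beta>)))"
    using NT.bounded_functional_mult(2)[OF \<omega>_bounded fC] .
  show "d \<in> closed_span NT {i s \<xi> \<otimes> star NT (i r \<eta>) | s r \<xi> \<eta>.
       s \<in> P \<and> r \<in> P \<and> \<xi> \<in> carrier (X s) \<and> \<eta> \<in> carrier (X r)}"
    using d spanned by simp
  fix d assume "d \<in> {i s \<xi> \<otimes> star NT (i r \<eta>) | s r \<xi> \<eta>.
       s \<in> P \<and> r \<in> P \<and> \<xi> \<in> carrier (X s) \<and> \<eta> \<in> carrier (X r)}"
  then obtain p q \<xi> \<eta> where pq: "p \<in> P" "q \<in> P" "\<xi> \<in> carrier (X p)" "\<eta> \<in> carrier (X q)"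
    and d: "d = i p \<xi> \<otimes> star NT (i q \<eta>)" by blast
  have dC: "d \<in> carrier NT" using pq d by simp
  define l where "l = ln (N p) - ln (N q)"
  have real: "exp (\<i> * complex_of_real t * complex_of_real l) * \<omega> (d \<otimes> \<sigma> t c) = \<omega> (d \<otimes> c)" for t
  proof -
    have "\<omega> (d \<otimes> c) = \<omega> (\<sigma> t (d \<otimes> c))" using c dC by (simp add: \<omega>_invariant del: comp_apply)
    also have "\<sigma> t (d \<otimes> c) = exp (\<i> * complex_of_real t * complex_of_real l) \<odot> (d \<otimes> \<sigma> t c)"
      using \<sigma>_hom[of t] c dC \<sigma>_generator[OF pq, of t, folded d l_def]
      by (simp add: star_hom_def NT.smult_mult_left)
    also have "\<omega> \<dots> = exp (\<i> * complex_of_real t * complex_of_real l) * \<omega> (d \<otimes> \<sigma> t c)"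
      using \<omega>_bounded c dC by (simp add: NT.bounded_functional_def)
    finally show ?thesis by simp
  qed
  \<comment> \<open>\<open>real\<close> says that this entire function vanishes on the real line. At
    \<open>\<i>\<beta>\<close> its exponential becomes \<open>exp (- \<beta> * l)\<close>.\<close>
  define H where "H = (\<lambda>z. exp (\<i> * z * complex_of_real l) * \<omega> (d \<otimes> f z) - \<omega> (d \<otimes> c))"
  have "H holomorphic_on UNIV"
    unfolding H_def
    by (intro holomorphic_intros NT.bounded_functional_holomorphic[OF _ ent]
        NT.bounded_functional_mult(1)[OF \<omega>_bounded dC])
  moreover have "H (complex_of_real t) = 0" for t
    unfolding H_def f_real real by simp
  ultimately have "H (\<i> * complex_of_real \<beta>) = 0"
    by (rule entire_eq_zero_if_zero_on_reals)
  then have "\<omega> (d \<otimes> c) = complex_of_real (exp (- \<beta> * l)) * \<omega> (d \<otimes> f (\<i> * complex_of_real \<beta>))"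
    by (simp add: H_def exp_of_real[symmetric] del: comp_apply)
  \<comment> \<open>The twisted trace relation yields the same nonzero factor as the continuation,
    so it cancels.\<close>
  moreover have "\<omega> (d \<otimes> c) = complex_of_real (exp (- \<beta> * l)) * \<omega> (c \<otimes> d)"
  proof -
    have "N p powr - \<beta> / N q powr - \<beta> = exp (- \<beta> * l)"
      using N_pos[OF pq(1)] N_pos[OF pq(2)] by (simp add: powr_def l_def algebra_simps flip: exp_diff)
    then show ?thesis using scales_generator[OF pq, folded d] c unfolding scales_def by metis
  qed
  ultimately show "\<omega> (c \<otimes> d) = \<omega> (d \<otimes> f (\<i> * complex_of_real \<beta>))"
    by simp
qed

lemma kms_state_\<omega>: "kms_state NT \<sigma> \<beta> \<omega>"
  using state_\<omega> kms_condition by (auto simp: kms_state_def analytic_element_def)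

end

end

theorem theorem3p8:
  fixes A :: "'a cstar" and G :: "'g monoid" and P :: "'g set"
    and X :: "('g, 'a) fibres" and mul :: "('g, 'a) fibre_mult"
    and n :: "'g \<Rightarrow> nat" and v :: "'g \<Rightarrow> nat \<Rightarrow> 'a"
    and NT :: "'c cstar" and i :: "'g \<Rightarrow> 'a \<Rightarrow> 'c"
    and \<Phi> :: "'c \<Rightarrow> 'c" and N :: "'g \<Rightarrow> real" and \<sigma> :: "real \<Rightarrow> 'c \<Rightarrow> 'c"
    and \<beta> :: real and \<phi> :: "'c \<Rightarrow> complex"
  assumes "product_system A G P X mul"
    and "compactly_aligned A G P X mul"
    and "finite_type A G P X mul n v"
    and "nica_toeplitz_algebra A G P X mul NT i"
    and "core_expectation P X NT i \<Phi>"
    and "positive_reals_hom G N" and "inj_on N (carrier G)"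
    and "dynamics_from A G P X NT i N \<sigma>"
    and "0 < \<beta>"
    and "tracial_state (core P X NT i) \<phi>"
    and "\<And>y s j l. \<lbrakk>y \<in> carrier (core P X NT i); s \<in> P; j < n s; l < n s\<rbrakk> \<Longrightarrow>
           \<phi> (i s (v s j) \<otimes>\<^bsub>NT\<^esub> y \<otimes>\<^bsub>NT\<^esub> star NT (i s (v s l)))
             = (if j = l then complex_of_real (N s powr - \<beta>) * \<phi> y else 0)"
    and "\<And>y s r j l. \<lbrakk>y \<in> carrier (core P X NT i); s \<in> P; r \<in> P; s \<noteq> r; j < n s; l < n r\<rbrakk> \<Longrightarrow>
           (\<phi> \<circ> \<Phi>) (i s (v s j) \<otimes>\<^bsub>NT\<^esub> y \<otimes>\<^bsub>NT\<^esub> star NT (i r (v r l))) = 0"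
  shows "kms_state NT \<sigma> \<beta> (\<phi> \<circ> \<Phi>)"
proof -
  interpret toeplitz_core A G P X mul NT n v i \<Phi>
    using assms(1,3-5)
    by (auto simp: toeplitz_core_def toeplitz_core_axioms_def nica_toeplitz_algebra_def nica_rep_def)
  \<comment> \<open>\<open>scaling\<close> is the diagonal instance \<open>l = j\<close>, where the
    conditional collapses.\<close>
  interpret scaling_trace A G P X mul NT n v i \<Phi> \<phi> N \<beta>
    by unfold_locales (use assms(6,10,11) in auto)
  show ?thesis by (rule kms_state_\<omega>) fact
qed

end
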